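(* For all $x>0$ and $\nu>0$, $$V(x,\nu)=4\sum_{N=1}^\infty\sigma_0(N)\bigl(K_0(2\pi N\nu x^{-2})-x^2K_0(2\pi N\nu x^2)\bigr)$$ and $$V(x,\nu)=x^2\log x^2+x^2\log Q\nu+\log x^2-\log Q\nu+\frac{x}{\sqrt\nu}\Bigl[E(\nu x^{-2})-E(\nu x^2)\Bigr],$$ where $K_0(t)$ is the $K$-Bessel function of index $0$ and $\sigma_0(N)=\sum_{d\mid N}1$.
   Context: Let $\theta(x)=\sum_{k\in\mathbb{Z}}e^{-\pi k^2x}$ and, for $a,b>0$, $$w_{a,b}(x)=(\theta(a^2x^{-2})-1)(\theta(b^2x^{-2})-1)-x^2(\theta(a^2x^2)-1)(\theta(b^2x^2)-1).$$ For $\nu>0$ and $x>0$, $V(x,\nu)=\int_0^\infty w_{a,\nu a^{-1}}(x)\frac{da}{a}$. The completed non-holomorphic Eisenstein series is defined for $z=x+iy$, $y>0$, $\Re(s)>1$ by $$E^*(z,s)=\frac12\pi^{-s}\Gamma(s)\sum_{(m,n)\in\mathbb{Z}^2\setminus\{(0,0)\}}\frac{y^s}{|mz+n|^{2s}},$$ and, for fixed $z$, is continued holomorphically to the whole $s$-plane except for simple poles at $s=0,1$. Put $E(y)=E^*(iy,1/2)$ for $y>0$, and $Q=(4\pi)^{-1}e^{\gamma}$, where $\gamma=0.57721\ldots$ is Euler's constant. Here $\log Q\nu$ means $\log(Q\nu)$. *)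

theory Defs
  imports "HOL-Complex_Analysis.Complex_Analysis"
begin

definition theta :: "real \<Rightarrow> real" where
  "theta x = (\<Sum>\<^sub>\<infinity>k::int. exp (- pi * (real_of_int k)\<^sup>2 * x))"

definition w_ab :: "real \<Rightarrow> real \<Rightarrow> real \<Rightarrow> real" where
  "w_ab a b x =
     (theta (a\<^sup>2 / x\<^sup>2) - 1) * (theta (b\<^sup>2 / x\<^sup>2) - 1)
     - x\<^sup>2 * (theta (a\<^sup>2 * x\<^sup>2) - 1) * (theta (b\<^sup>2 * x\<^sup>2) - 1)"

definition V_fun :: "real \<Rightarrow> real \<Rightarrow> real" where
  "V_fun x \<nu> = (LBINT a:{0<..}. w_ab a (\<nu> / a) x / a)"

text \<open>The modified Bessel function of the second kind of real index and positive argument,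
  by its standard integral representation.\<close>

definition bessel_K :: "real \<Rightarrow> real \<Rightarrow> real" where
  "bessel_K \<mu> t = (LBINT u:{0<..}. exp (- t * cosh u) * cosh (\<mu> * u))"

definition sigma0 :: "nat \<Rightarrow> nat" where
  "sigma0 N = (\<Sum>d | d dvd N. 1)"

definition eisenstein_series :: "complex \<Rightarrow> complex \<Rightarrow> complex" where
  "eisenstein_series z s =
     1/2 * complex_of_real pi powr (- s) * Gamma s *
     (\<Sum>\<^sub>\<infinity>(m::int, n::int)\<in>UNIV - {(0, 0)}.
        complex_of_real (Im z) powr s / complex_of_real (cmod (of_int m * z + of_int n)) powr (2 * s))"

text \<open>The continuation in \<open>s\<close>. As \<open>-{0, 1}\<close> is open and connected, the choice below has at most
  one candidate up to its (irrelevant) values at the poles \<open>0\<close> and \<open>1\<close>.\<close>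

definition eisenstein_star :: "complex \<Rightarrow> complex \<Rightarrow> complex" where
  "eisenstein_star z =
     (SOME f. f holomorphic_on (- {0, 1}) \<and> (\<forall>s. Re s > 1 \<longrightarrow> f s = eisenstein_series z s))"

definition E_half :: "real \<Rightarrow> complex" where
  "E_half y = eisenstein_star (\<i> * complex_of_real y) (1/2)"

definition Q_const :: real where
  "Q_const = inverse (4 * pi) * exp euler_mascheroni"

end

theory Submission
  imports Defs "HOL-Probability.Probability"
begin

text \<open>
  Both formulas come from one function of one variable,
  the integral \<open>S(y)\<close> of \<open>(\<theta>(y \<tau>) - 1) (\<theta>(y/\<tau>) - 1) d\<tau>/(2\<tau>)\<close> over \<open>\<tau> > 0\<close>, called \<open>theta_conv\<close> here. The substitution
  \<open>\<tau> = a\<^sup>2/\<nu>\<close> gives \<open>V(x, \<nu>) = S(\<nu> x\<^sup>-\<^sup>2) - x\<^sup>2 S(\<nu> x\<^sup>2)\<close> (\<open>V_fun_eq_theta_conv\<close>), so it is enough to evaluate \<open>S\<close> in two ways.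

  Expanding both theta series and integrating termwise, the term of \<open>(m, n)\<close> becomes a Bessel
  integral that depends only on \<open>N = m n\<close>. Hence \<open>S(y) = 4 \<Sum> \<sigma>\<^sub>0(N) K\<^sub>0(2 \<pi> N y)\<close> (\<open>theta_conv_sums\<close>).

  For the second evaluation, \<open>\<theta>(1/x) = sqrt x \<theta>(x)\<close> (\<open>theta_inversion\<close>) is applied to one factor. By the symmetry
  \<open>\<tau> \<mapsto> 1/\<tau>\<close> the integral may be taken over \<open>[1, \<infinity>)\<close>, and there inversion turns the product of the two
  factors into the two-dimensional theta function \<open>\<theta>(y t) \<theta>(t/y)\<close>. Half the Mellin transform of that function, without its
  constant term \<open>1\<close>, is the completed Eisenstein series at \<open>z = i y\<close>; splitting it at \<open>1\<close> as Riemann did for the zeta function yields the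
  continuation (\<open>eisenstein_star_eq\<close>) and a convergent integral for the value at \<open>s = 1/2\<close> (\<open>E_half_eq\<close>).

  The two integrals differ by one-dimensional ones, which together form a regularized Mellin
  transform of \<open>\<theta> - 1\<close> at the pole \<open>s = 1\<close> of \<open>2 \<pi>\<^bsup>-s/2\<^esup> \<Gamma>(s/2) \<zeta>(s)\<close>. Its value follows from the constant term
  \<open>\<gamma>\<close> of \<open>\<zeta>\<close> at \<open>1\<close> and from \<open>\<psi>(1/2) = - \<gamma> - 2 log 2\<close> (\<open>theta_regularized_at_half\<close>). This is where \<open>Q = e\<^sup>\<gamma>/(4 \<pi>)\<close> comes from:
  \<open>S(y) = E(y) / sqrt y - log (Q y)\<close> (\<open>theta_conv_eq_E_half\<close>).
\<close>

section \<open>Sums and integrals\<close>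

text \<open>Dominated convergence for an unordered sum: the finite partial sums are all bounded by the
  integrable sum \<open>g\<close> of the norms. A countable index type is transported to the natural numbers,
  where termwise integration of a series applies. All interchanges of an infinite sum and an integral
  below are instances.\<close>

lemma has_sum_set_integral:
  fixes f :: "'i::countable \<Rightarrow> 'a \<Rightarrow> 'b::{banach,second_countable_topology}"
  assumes int: "\<And>i. i \<in> A \<Longrightarrow> set_integrable M S (f i)"
    and dom: "\<And>x. x \<in> S \<Longrightarrow> ((\<lambda>i. norm (f i x)) has_sum g x) A"
    and g: "set_integrable M S g"
  shows "((\<lambda>i. LINT x:S|M. f i x) has_sum (LINT x:S|M. (\<Sum>\<^sub>\<infinity>i\<in>A. f i x))) A"
proof -
  define F where "F = (\<lambda>n x. if n \<in> to_nat ` A then indicator S x *\<^sub>R f (from_nat n) x else 0)"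
  have transfer: "(h has_sum c) A \<longleftrightarrow> ((\<lambda>n. if n \<in> to_nat ` A then h (from_nat n) else 0) has_sum c) UNIV"
    for h :: "'i \<Rightarrow> 'c::{comm_monoid_add,topological_space}" and c
  proof -
    have "(h has_sum c) A \<longleftrightarrow> ((\<lambda>n. h (from_nat n)) has_sum c) (to_nat ` A)"
      by (subst has_sum_reindex) (auto simp: o_def)
    also have "\<dots> \<longleftrightarrow> ((\<lambda>n. if n \<in> to_nat ` A then h (from_nat n) else 0) has_sum c) UNIV"
      by (rule has_sum_cong_neutral) auto
    finally show ?thesis .
  qed
  have Fint: "integrable M (F n)" for n
    using int by (cases "n \<in> to_nat ` A") (auto simp: F_def set_integrable_def)
  have normF: "(\<lambda>n. norm (F n x)) sums (indicator S x * g x)" for x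
  proof (cases "x \<in> S")
    case True
    from dom[OF True] have "((\<lambda>n. if n \<in> to_nat ` A then norm (f (from_nat n) x) else 0) has_sum g x) UNIV"
      by (simp only: transfer)
    hence "(\<lambda>n. if n \<in> to_nat ` A then norm (f (from_nat n) x) else 0) sums g x"
      by (rule has_sum_imp_sums)
    also have "(\<lambda>n. if n \<in> to_nat ` A then norm (f (from_nat n) x) else 0) = (\<lambda>n. norm (F n x))"
      using True by (auto simp: F_def)
    finally show ?thesis using True by simp
  next
    case False
    hence "F n x = 0" for n by (auto simp: F_def)
    thus ?thesis using False by simp
  qed
  have gint: "integrable M (\<lambda>x. indicator S x * g x)"
    using g by (simp add: set_integrable_def)
  have sumint: "summable (\<lambda>n. LINT x|M. norm (F n x))"
  proof (rule bounded_imp_summable)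
    show "0 \<le> (LINT x|M. norm (F n x))" for n by simp
    show "(\<Sum>k\<le>n. LINT x|M. norm (F k x)) \<le> (LINT x|M. indicator S x * g x)" for n
    proof -
      have "(\<Sum>k\<le>n. LINT x|M. norm (F k x)) = (LINT x|M. (\<Sum>k\<le>n. norm (F k x)))"
        using Fint by (subst Bochner_Integration.integral_sum) auto
      also have "\<dots> \<le> (LINT x|M. indicator S x * g x)"
      proof (rule integral_mono)
        show "(\<Sum>k\<le>n. norm (F k x)) \<le> indicator S x * g x" for x
          unfolding sums_unique[OF normF[of x]]
          by (rule sum_le_suminf[OF sums_summable[OF normF[of x]]]) auto
      qed (use Fint gint in auto)
      finally show ?thesis .
    qed
  qed
  have AE: "AE x in M. summable (\<lambda>n. norm (F n x))"
    using normF by (auto intro: sums_summable)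
  note thms = Fint AE sumint
  have pw: "(\<Sum>n. F n x) = indicator S x *\<^sub>R (\<Sum>\<^sub>\<infinity>i\<in>A. f i x)" for x
  proof (cases "x \<in> S")
    case True
    have "(\<lambda>i. f i x) summable_on A"
      using has_sum_imp_summable[OF dom[OF True]] by (rule abs_summable_summable)
    hence "((\<lambda>i. f i x) has_sum (\<Sum>\<^sub>\<infinity>i\<in>A. f i x)) A" by simp
    hence "((\<lambda>n. if n \<in> to_nat ` A then f (from_nat n) x else 0) has_sum (\<Sum>\<^sub>\<infinity>i\<in>A. f i x)) UNIV"
      by (simp only: transfer)
    moreover have "(\<lambda>n. if n \<in> to_nat ` A then f (from_nat n) x else 0) = (\<lambda>n. F n x)"
      using True by (auto simp: F_def)
    ultimately have "((\<lambda>n. F n x) has_sum (\<Sum>\<^sub>\<infinity>i\<in>A. f i x)) UNIV" by simp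
    from sums_unique[OF has_sum_imp_sums[OF this]] show ?thesis using True by simp
  next
    case False
    hence "F n x = 0" for n by (auto simp: F_def)
    thus ?thesis using False by simp
  qed
  have "(\<lambda>n. LINT x|M. F n x) sums (LINT x|M. (\<Sum>n. F n x))"
    using sums_integral[OF thms] .
  moreover have "summable (\<lambda>n. norm (LINT x|M. F n x))"
    by (rule summable_comparison_test[OF _ sumint]) (auto intro!: integral_norm_bound)
  ultimately have "((\<lambda>n. LINT x|M. F n x) has_sum (LINT x|M. (\<Sum>n. F n x))) UNIV"
    by (intro norm_summable_imp_has_sum)
  also have "(\<lambda>n. LINT x|M. F n x) = (\<lambda>n. if n \<in> to_nat ` A then LINT x:S|M. f (from_nat n) x else 0)"
    by (auto simp: F_def set_lebesgue_integral_def)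
  finally show "((\<lambda>i. LINT x:S|M. f i x) has_sum (LINT x:S|M. (\<Sum>\<^sub>\<infinity>i\<in>A. f i x))) A"
    by (simp only: transfer pw set_lebesgue_integral_def)
qed

lemma has_sum_single:
  fixes f :: "'a \<Rightarrow> 'b::{comm_monoid_add,topological_space}"
  assumes "a \<in> A" "\<And>x. x \<in> A \<Longrightarrow> x \<noteq> a \<Longrightarrow> f x = 0" "f a = c"
  shows "(f has_sum c) A"
proof -
  have "(f has_sum c) {a}" using assms(3) by (intro has_sum_finiteI) auto
  also have "?this \<longleftrightarrow> ?thesis"
    using assms by (intro has_sum_cong_neutral) auto
  finally show ?thesis .
qed

lemma has_sum_product_nonneg:
  fixes a :: "'a \<Rightarrow> real" and b :: "'b \<Rightarrow> real"
  assumes a: "(a has_sum A) X" and b: "(b has_sum B) Y"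
    and a0: "\<And>m. m \<in> X \<Longrightarrow> a m \<ge> 0" and b0: "\<And>n. n \<in> Y \<Longrightarrow> b n \<ge> 0"
  shows "((\<lambda>(m, n). a m * b n) has_sum A * B) (X \<times> Y)"
proof -
  let ?f = "\<lambda>p. a (fst p) * b (snd p)"
  have inner: "((\<lambda>n. ?f (m, n)) has_sum a m * B) Y" for m
    using has_sum_cmult_right[OF b] by simp
  have outer: "((\<lambda>m. a m * B) has_sum A * B) X"
    by (rule has_sum_cmult_left[OF a])
  have "(?f has_sum A * B) (X \<times> Y)"
  proof (rule has_sum_SigmaI[OF inner outer])
    show "?f summable_on X \<times> Y"
      by (rule summable_on_SigmaI[OF inner]) (use outer a0 b0 in \<open>auto dest: has_sum_imp_summable\<close>)
  qed
  thus ?thesis by (simp add: case_prod_unfold)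
qed

lemma continuous_on_infsum:
  fixes f :: "'i \<Rightarrow> 'a::topological_space \<Rightarrow> 'b::banach"
  assumes "\<And>i. i \<in> A \<Longrightarrow> continuous_on S (f i)"
    and "\<And>i x. i \<in> A \<Longrightarrow> x \<in> S \<Longrightarrow> norm (f i x) \<le> M i"
    and "M summable_on A"
  shows "continuous_on S (\<lambda>x. \<Sum>\<^sub>\<infinity>i\<in>A. f i x)"
proof (rule uniform_limit_theorem)
  show "uniform_limit S (\<lambda>X y. \<Sum>i\<in>X. f i y) (\<lambda>y. \<Sum>\<^sub>\<infinity>i\<in>A. f i y) (finite_subsets_at_top A)"
    by (rule Weierstrass_m_test_general) (use assms in auto)
  show "\<forall>\<^sub>F X in finite_subsets_at_top A. continuous_on S (\<lambda>y. \<Sum>i\<in>X. f i y)"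
    using assms(1) by (intro eventually_finite_subsets_at_top_weakI continuous_on_sum) auto
qed auto

text \<open>Continuity provides the Borel measurability that lets Henstock--Kurzweil results,
  which speak about Lebesgue measure, be read for Borel set integrals.\<close>

lemma set_integrable_lborel_iff_lebesgue:
  fixes f :: "real \<Rightarrow> 'b::euclidean_space"
  assumes "continuous_on S f" "S \<in> sets borel"
  shows "set_integrable lborel S f \<longleftrightarrow> f absolutely_integrable_on S"
    and "(LBINT x:S. f x) = (LINT x:S|lebesgue. f x)"
proof -
  have m: "(\<lambda>x. indicator S x *\<^sub>R f x) \<in> borel_measurable lborel"
    using borel_measurable_continuous_on_indicator[OF assms(2,1)] by simp
  show "set_integrable lborel S f \<longleftrightarrow> f absolutely_integrable_on S"
    using integrable_completion[OF m] by (simp add: set_integrable_def)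
  show "(LBINT x:S. f x) = (LINT x:S|lebesgue. f x)"
    using integral_completion[OF m] by (simp add: set_lebesgue_integral_def)
qed

text \<open>Stated as an equivalence for integrability, because in several substitutions it is the
  substituted side whose integrability is known.\<close>

lemma set_integral_change_of_variables_real:
  fixes f g g' :: "real \<Rightarrow> real"
  assumes f: "continuous_on T f" and g': "continuous_on S g'"
    and der: "\<And>x. x \<in> S \<Longrightarrow> (g has_field_derivative g' x) (at x within S)"
    and bij: "bij_betw g S T"
    and [measurable]: "S \<in> sets borel" "T \<in> sets borel"
  shows "set_integrable lborel T f \<longleftrightarrow> set_integrable lborel S (\<lambda>x. \<bar>g' x\<bar> * f (g x))" (is "?A \<longleftrightarrow> ?B")
    and "(LBINT x:T. f x) = (LBINT x:S. \<bar>g' x\<bar> * f (g x))"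
proof -
  have im: "g ` S = T" and inj: "inj_on g S" using bij by (auto simp: bij_betw_def)
  have cg: "continuous_on S g"
    using der by (meson DERIV_continuous continuous_on_eq_continuous_within)
  have c: "continuous_on S (\<lambda>x. \<bar>g' x\<bar> * f (g x))"
    by (intro continuous_intros g' continuous_on_compose2[OF f cg]) (auto simp: im)
  have Sl: "S \<in> sets lebesgue" by simp
  note cov = has_absolute_integral_change_of_variables_1'[OF Sl der inj, of f, unfolded im]
  note e1 = set_integrable_lborel_iff_lebesgue[OF f \<open>T \<in> sets borel\<close>]
  note e2 = set_integrable_lborel_iff_lebesgue[OF c \<open>S \<in> sets borel\<close>]
  show AB: "?A \<longleftrightarrow> ?B" using cov[of "integral T f"] cov[of "integral S (\<lambda>x. \<bar>g' x\<bar> * f (g x))"] e1(1) e2(1) by blast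
  show "(LBINT x:T. f x) = (LBINT x:S. \<bar>g' x\<bar> * f (g x))"
  proof (cases ?A)
    case True
    hence i1: "f absolutely_integrable_on T" and i2: "(\<lambda>x. \<bar>g' x\<bar> * f (g x)) absolutely_integrable_on S"
      using AB e1(1) e2(1) by blast+
    have "integral S (\<lambda>x. \<bar>g' x\<bar> * f (g x)) = integral T f"
      using cov[of "integral T f"] i1 by blast
    thus ?thesis
      unfolding e1(2) e2(2) set_lebesgue_integral_eq_integral(2)[OF i1] set_lebesgue_integral_eq_integral(2)[OF i2] ..
  next
    case False
    hence "\<not> ?B" using AB by simp
    with False show ?thesis
      by (simp add: set_integrable_def set_lebesgue_integral_def not_integrable_integral_eq)
  qed
qed

lemma set_integrable_complex_iff:
  fixes f :: "'a \<Rightarrow> complex"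
  shows "set_integrable M S f \<longleftrightarrow> set_integrable M S (\<lambda>x. Re (f x)) \<and> set_integrable M S (\<lambda>x. Im (f x))"
proof -
  have "integrable M h \<longleftrightarrow> integrable M (\<lambda>x. Re (h x)) \<and> integrable M (\<lambda>x. Im (h x))" for h :: "'a \<Rightarrow> complex"
  proof safe
    assume "integrable M (\<lambda>x. Re (h x))" "integrable M (\<lambda>x. Im (h x))"
    hence "integrable M (\<lambda>x. complex_of_real (Re (h x)) + \<i> * complex_of_real (Im (h x)))"
      by (intro Bochner_Integration.integrable_add integrable_mult_right integrable_of_real)
    thus "integrable M h" by (simp add: complex_eq[symmetric])
  qed auto
  from this[of "\<lambda>x. indicator S x *\<^sub>R f x"] show ?thesis
    by (simp add: set_integrable_def)
qed

text \<open>The real case for the real and the imaginary part.\<close>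

lemma set_integral_change_of_variables_complex:
  fixes f :: "real \<Rightarrow> complex" and g g' :: "real \<Rightarrow> real"
  assumes f: "continuous_on T f" and g': "continuous_on S g'"
    and der: "\<And>x. x \<in> S \<Longrightarrow> (g has_field_derivative g' x) (at x within S)"
    and bij: "bij_betw g S T"
    and SB: "S \<in> sets borel" and TB: "T \<in> sets borel"
  shows "set_integrable lborel T f \<longleftrightarrow> set_integrable lborel S (\<lambda>x. \<bar>g' x\<bar> *\<^sub>R f (g x))" (is "?A \<longleftrightarrow> ?B")
    and "(LBINT x:T. f x) = (LBINT x:S. \<bar>g' x\<bar> *\<^sub>R f (g x))"
proof -
  have cR: "continuous_on T (\<lambda>x. Re (f x))" and cI: "continuous_on T (\<lambda>x. Im (f x))"
    using f by (auto intro: continuous_intros)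
  note R = set_integral_change_of_variables_real[OF cR g' der bij SB TB]
  note I = set_integral_change_of_variables_real[OF cI g' der bij SB TB]
  show AB: "?A \<longleftrightarrow> ?B"
    by (subst (1 2) set_integrable_complex_iff) (simp add: R I)
  show "(LBINT x:T. f x) = (LBINT x:S. \<bar>g' x\<bar> *\<^sub>R f (g x))"
  proof (cases ?A)
    case True
    hence B: ?B using AB by simp
    have e: "Re (LBINT x:U. h x) = (LBINT x:U. Re (h x))" "Im (LBINT x:U. h x) = (LBINT x:U. Im (h x))"
      if "set_integrable lborel U h" for U and h :: "real \<Rightarrow> complex"
      using that unfolding set_integrable_def set_lebesgue_integral_def
      by (auto simp: integral_Re[symmetric] integral_Im[symmetric])
    show ?thesis
      by (rule complex_eqI) (simp_all add: e[OF True] e[OF B] R I)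
  next
    case False
    hence "\<not> ?B" using AB by simp
    with False show ?thesis
      by (simp add: set_integrable_def set_lebesgue_integral_def not_integrable_integral_eq)
  qed
qed

lemma set_integral_rescale:
  fixes f :: "real \<Rightarrow> real"
  assumes c: "c > 0" and f: "continuous_on {c..} f"
  shows "(LBINT t:{c..}. f t) = (LBINT t:{1..}. c * f (c * t))"
    and "set_integrable lborel {c..} f \<longleftrightarrow> set_integrable lborel {1..} (\<lambda>t. c * f (c * t))"
proof -
  have bij: "bij_betw (\<lambda>t. c * t) {1..} {c..}"
    by (rule bij_betw_byWitness[where f' = "\<lambda>t. t / c"]) (use c in \<open>auto simp: field_simps\<close>)
  have der: "((\<lambda>t. c * t) has_field_derivative c) (at t within {1..})" for t
    by (auto intro!: derivative_eq_intros)
  note cv = set_integral_change_of_variables_real[OF f continuous_on_const der bij]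
  show "(LBINT t:{c..}. f t) = (LBINT t:{1..}. c * f (c * t))"
    "set_integrable lborel {c..} f \<longleftrightarrow> set_integrable lborel {1..} (\<lambda>t. c * f (c * t))"
    using cv c by simp_all
qed

lemma bij_betw_inversion:
  assumes "c > (0::real)"
  shows "bij_betw (\<lambda>t. 1 / t) {1/c..} {0<..c}"
proof (rule bij_betw_byWitness[where f' = "\<lambda>t. 1 / t"])
  have "t > 0" "1 / t \<le> c" if "t \<ge> 1 / c" for t
  proof -
    show "t > 0" using that assms less_le_trans[of 0 "1/c" t] by simp
    thus "1 / t \<le> c" using that assms by (simp add: field_simps)
  qed
  thus "(\<lambda>t. 1 / t) ` {1/c..} \<subseteq> {0<..c}" by auto
  show "(\<lambda>t. 1 / t) ` {0<..c} \<subseteq> {1/c..}" using assms by (auto simp: frac_le)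
qed auto

lemma inversion_side_conditions:
  assumes c: "c > (0::real)"
  shows "continuous_on {1/c..} (\<lambda>t. - 1 / t\<^sup>2)"
    and "\<And>t. t \<in> {1/c..} \<Longrightarrow> ((\<lambda>t. 1 / t) has_field_derivative (- 1 / t\<^sup>2)) (at t within {1/c..})"
proof -
  have pos: "t > 0" if "t \<in> {1/c..}" for t
    using that c less_le_trans[of 0 "1/c" t] by auto
  show "continuous_on {1/c..} (\<lambda>t. - 1 / t\<^sup>2)" using pos c by (auto intro!: continuous_intros)
  show "((\<lambda>t. 1 / t) has_field_derivative (- 1 / t\<^sup>2)) (at t within {1/c..})" if "t \<in> {1/c..}" for t
    using pos[OF that] by (auto intro!: derivative_eq_intros simp: power2_eq_square field_simps)
qed

lemma set_integral_inversion_real: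
  fixes f :: "real \<Rightarrow> real"
  assumes "continuous_on {0<..c} f" "c > 0"
  shows "set_integrable lborel {0<..c} f \<longleftrightarrow> set_integrable lborel {1/c..} (\<lambda>t. f (1 / t) / t\<^sup>2)"
    and "(LBINT t:{0<..c}. f t) = (LBINT t:{1/c..}. f (1 / t) / t\<^sup>2)"
proof -
  note cv = set_integral_change_of_variables_real[OF assms(1) inversion_side_conditions(1)[OF assms(2)]
      inversion_side_conditions(2)[OF assms(2)] bij_betw_inversion[OF assms(2)]]
  have eq: "\<bar>- 1 / t\<^sup>2\<bar> * f (1 / t) = f (1 / t) / t\<^sup>2" for t by simp
  show "set_integrable lborel {0<..c} f \<longleftrightarrow> set_integrable lborel {1/c..} (\<lambda>t. f (1 / t) / t\<^sup>2)"
    by (subst cv(1)) (simp_all only: eq, auto)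
  show "(LBINT t:{0<..c}. f t) = (LBINT t:{1/c..}. f (1 / t) / t\<^sup>2)"
    by (subst cv(2)) (simp_all only: eq, auto)
qed

lemma set_integral_inversion_complex:
  fixes f :: "real \<Rightarrow> complex"
  assumes "continuous_on {0<..c} f" "c > 0"
  shows "set_integrable lborel {0<..c} f \<longleftrightarrow> set_integrable lborel {1/c..} (\<lambda>t. f (1 / t) / of_real (t\<^sup>2))"
    and "(LBINT t:{0<..c}. f t) = (LBINT t:{1/c..}. f (1 / t) / of_real (t\<^sup>2))"
proof -
  note cv = set_integral_change_of_variables_complex[OF assms(1) inversion_side_conditions(1)[OF assms(2)]
      inversion_side_conditions(2)[OF assms(2)] bij_betw_inversion[OF assms(2)]]
  have eq: "\<bar>- 1 / t\<^sup>2\<bar> *\<^sub>R f (1 / t) = f (1 / t) / of_real (t\<^sup>2)" for t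
    by (simp add: scaleR_conv_of_real)
  show "set_integrable lborel {0<..c} f \<longleftrightarrow> set_integrable lborel {1/c..} (\<lambda>t. f (1 / t) / of_real (t\<^sup>2))"
    by (subst cv(1)) (simp_all only: eq, auto)
  show "(LBINT t:{0<..c}. f t) = (LBINT t:{1/c..}. f (1 / t) / of_real (t\<^sup>2))"
    by (subst cv(2)) (simp_all only: eq, auto)
qed

lemma set_integrable_continuous_dominated:
  fixes f :: "real \<Rightarrow> 'b::euclidean_space" and g :: "real \<Rightarrow> real"
  assumes "set_integrable lborel S g" "continuous_on S f" "S \<in> sets borel"
    and "\<And>x. x \<in> S \<Longrightarrow> norm (f x) \<le> g x"
  shows "set_integrable lborel S f"
proof (rule set_integrable_bound[OF assms(1)])
  show "set_borel_measurable lborel S f"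
    using assms(2,3) borel_measurable_continuous_on_indicator[of S f] by (simp add: set_borel_measurable_def)
  show "AE x in lborel. x \<in> S \<longrightarrow> norm (f x) \<le> norm (g x)"
    using assms(4) by (auto intro!: AE_I2 order_trans[OF assms(4)])
qed

lemma set_integral_dominated_convergence:
  fixes f :: "nat \<Rightarrow> real \<Rightarrow> real"
  assumes S: "S \<in> sets borel" and w: "set_integrable lborel S w"
    and cont: "\<And>k. continuous_on S (f k)" "continuous_on S g"
    and bound: "\<And>k x. x \<in> S \<Longrightarrow> norm (f k x) \<le> w x"
    and lim: "\<And>x. x \<in> S \<Longrightarrow> (\<lambda>k. f k x) \<longlonglongrightarrow> g x"
  shows "(\<lambda>k. LBINT x:S. f k x) \<longlonglongrightarrow> (LBINT x:S. g x)"
  unfolding set_lebesgue_integral_def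
proof (rule integral_dominated_convergence)
  show "integrable lborel (\<lambda>x. indicator S x *\<^sub>R w x)" using w by (simp add: set_integrable_def)
  show "(\<lambda>x. indicator S x *\<^sub>R g x) \<in> borel_measurable lborel"
    using borel_measurable_continuous_on_indicator[OF S cont(2)] by simp
  show "(\<lambda>x. indicator S x *\<^sub>R f k x) \<in> borel_measurable lborel" for k
    using borel_measurable_continuous_on_indicator[OF S cont(1)] by simp
  show "AE x in lborel. norm (indicator S x *\<^sub>R f k x) \<le> indicator S x *\<^sub>R w x" for k
    using bound by (intro AE_I2) (auto simp: indicator_def)
  show "AE x in lborel. (\<lambda>k. indicator S x *\<^sub>R f k x) \<longlonglongrightarrow> indicator S x *\<^sub>R g x"
    using lim by (intro AE_I2) (auto simp: indicator_def)
qed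

lemma set_integral_split_at:
  fixes f :: "real \<Rightarrow> 'b::{banach,second_countable_topology}"
  assumes "set_integrable lborel {0<..} f" "c > 0"
  shows "(LBINT t:{0<..}. f t) = (LBINT t:{0<..c}. f t) + (LBINT t:{c..}. f t)"
proof -
  have "{0<..} = {0<..c} \<union> {c..}" using assms(2) by auto
  moreover have "(LBINT t:{0<..c} \<union> {c..}. f t) = (LBINT t:{0<..c}. f t) + (LBINT t:{c..}. f t)"
  proof (rule set_integral_Un_AE)
    have "AE t in lborel. t \<noteq> c" by (rule AE_lborel_singleton)
    thus "AE t in lborel. \<not> (t \<in> {0<..c} \<and> t \<in> {c..})" by eventually_elim auto
    show "set_integrable lborel {0<..c} f" "set_integrable lborel {c..} f"
      by (rule set_integrable_subset[OF assms(1)]; use assms(2) in auto)+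
  qed auto
  ultimately show ?thesis by simp
qed

lemma set_integrable_split_at:
  fixes f :: "real \<Rightarrow> 'b::{banach,second_countable_topology}"
  assumes "set_integrable lborel {0<..c} f" "set_integrable lborel {c..} f" "c > 0"
  shows "set_integrable lborel {0<..} f"
proof -
  have "{0<..} = {0<..c} \<union> {c..}" using assms(3) by auto
  thus ?thesis using set_integrable_Un[OF assms(1,2)] by simp
qed

lemma has_integral_nonneg_imp_set_integral:
  fixes f :: "real \<Rightarrow> real"
  assumes "(f has_integral I) S" "\<And>x. x \<in> S \<Longrightarrow> f x \<ge> 0" "continuous_on S f" "S \<in> sets borel"
  shows "set_integrable lborel S f" "(LBINT x:S. f x) = I"
proof -
  have a: "f absolutely_integrable_on S"
    using assms(1,2) by (intro nonnegative_absolutely_integrable_1) auto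
  note e = set_integrable_lborel_iff_lebesgue[OF assms(3,4)]
  show "set_integrable lborel S f" using a e by simp
  show "(LBINT x:S. f x) = I"
    using a assms(1) e by (simp add: set_lebesgue_integral_eq_integral integral_unique)
qed

lemma set_integral_powr_to_inf:
  fixes c e :: real
  assumes "c > 0" "e < -1"
  shows "set_integrable lborel {c..} (\<lambda>t. t powr e)" "(LBINT t:{c..}. t powr e) = - (c powr (e+1)) / (e+1)"
proof -
  note * = has_integral_nonneg_imp_set_integral[OF has_integral_powr_to_inf[OF assms(2,1)]]
  show "set_integrable lborel {c..} (\<lambda>t. t powr e)" "(LBINT t:{c..}. t powr e) = - (c powr (e+1)) / (e+1)"
    by (rule *; use assms in \<open>auto intro!: continuous_intros\<close>)+
qed

lemma set_integral_powr_from_0: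
  fixes c e :: real
  assumes "c > 0" "e > -1"
  shows "set_integrable lborel {0<..c} (\<lambda>t. t powr e)" "(LBINT t:{0<..c}. t powr e) = c powr (e+1) / (e+1)"
proof -
  have "((\<lambda>t. t powr e) has_integral (c powr (e+1) / (e+1))) {0..c}"
    using has_integral_powr_from_0[of e c] assms by simp
  moreover have "negligible {x \<in> {0..c} - {0<..c}. x powr e \<noteq> 0}"
    by (rule negligible_subset[OF negligible_sing[of 0]]) auto
  moreover have "negligible {x \<in> {0<..c} - {0..c}. x powr e \<noteq> 0}"
    by (rule negligible_subset[OF negligible_empty]) auto
  ultimately have "((\<lambda>t. t powr e) has_integral (c powr (e+1) / (e+1))) {0<..c}"
    by (simp only: has_integral_spike_set_eq[of "{0..c}" "{0<..c}"])
  note * = has_integral_nonneg_imp_set_integral[OF this]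
  show "set_integrable lborel {0<..c} (\<lambda>t. t powr e)" "(LBINT t:{0<..c}. t powr e) = c powr (e+1) / (e+1)"
    by (rule *; use assms in \<open>auto intro!: continuous_intros\<close>)+
qed

section \<open>Jacobi's theta function\<close>

lemma exp_minus_one_ge:
  fixes x :: real
  assumes "x \<ge> 0" "j \<ge> 1"
  shows "exp x - 1 \<ge> x ^ j / fact j"
proof -
  have "(\<Sum>n\<in>{0, j}. x ^ n /\<^sub>R fact n) \<le> (\<Sum>n. x ^ n /\<^sub>R fact n)"
    using assms by (intro sum_le_suminf summable_exp_generic) auto
  also have "\<dots> = exp x" by (simp add: exp_def)
  finally show ?thesis using assms by (simp add: field_simps)
qed

lemma theta_term_le_geometric:
  fixes t :: real
  assumes "t \<ge> 0"
  shows "exp (- pi * (real (Suc n))\<^sup>2 * t) \<le> exp (- pi * t) ^ Suc n"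
proof -
  have "real (Suc n) * 1 \<le> real (Suc n) * real (Suc n)"
    by (intro mult_left_mono) auto
  hence "pi * t * real (Suc n) \<le> pi * t * (real (Suc n))\<^sup>2"
    using assms by (intro mult_left_mono) (auto simp: power2_eq_square)
  thus ?thesis
    by (simp only: exp_of_nat_mult[symmetric] exp_le_cancel_iff) (simp add: algebra_simps)
qed

lemma theta_term_summable:
  assumes "t > (0::real)"
  shows "summable (\<lambda>n. exp (- pi * (real (Suc n))\<^sup>2 * t))"
proof (rule summable_comparison_test)
  show "\<exists>N. \<forall>n\<ge>N. norm (exp (- pi * (real (Suc n))\<^sup>2 * t)) \<le> exp (- pi * t) ^ Suc n"
    using theta_term_le_geometric[of t] assms by (intro exI[of _ 0]) simp
  show "summable (\<lambda>n. exp (- pi * t) ^ Suc n)"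
    using assms by (subst summable_Suc_iff) (auto intro!: summable_geometric)
qed

lemma
  assumes "t > 0"
  shows theta_has_sum: "((\<lambda>k::int. exp (- pi * (real_of_int k)\<^sup>2 * t)) has_sum theta t) UNIV"
    and theta_sums: "(\<lambda>n. 2 * exp (- pi * (real (Suc n))\<^sup>2 * t)) sums (theta t - 1)"
proof -
  let ?f = "\<lambda>k::int. exp (- pi * (real_of_int k)\<^sup>2 * t)"
  define c where "c = (\<Sum>n. exp (- pi * (real (Suc n))\<^sup>2 * t))"
  note sm = theta_term_summable[OF assms]
  have hs: "((\<lambda>n. exp (- pi * (real (Suc n))\<^sup>2 * t)) has_sum c) UNIV"
    using sm unfolding c_def
    by (intro norm_summable_imp_has_sum summable_sums) auto
  have P: "(?f has_sum c) ((\<lambda>n. int (Suc n)) ` UNIV)"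
    by (subst has_sum_reindex) (use hs in \<open>auto simp: o_def inj_def\<close>)
  have N: "(?f has_sum c) ((\<lambda>n. - int (Suc n)) ` UNIV)"
    by (subst has_sum_reindex) (use hs in \<open>auto simp: o_def inj_def power2_eq_square algebra_simps\<close>)
  have Z: "(?f has_sum 1) {0}" by (rule has_sum_finiteI) auto
  have "(?f has_sum (c + (c + 1))) (range (\<lambda>n. int (Suc n)) \<union> (range (\<lambda>n. - int (Suc n)) \<union> {0}))"
    by (intro has_sum_Un_disjoint P N Z) auto
  moreover have "range (\<lambda>n. int (Suc n)) \<union> (range (\<lambda>n. - int (Suc n)) \<union> {0}) = UNIV"
  proof -
    have "k \<in> range (\<lambda>n. int (Suc n)) \<union> (range (\<lambda>n. - int (Suc n)) \<union> {0})" for k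
    proof (cases k "0::int" rule: linorder_cases)
      case less
      hence "k = - int (Suc (nat (-k) - 1))" by simp
      thus ?thesis by blast
    next
      case greater
      hence "k = int (Suc (nat k - 1))" by simp
      thus ?thesis by blast
    qed simp
    thus ?thesis by blast
  qed
  ultimately have H: "(?f has_sum (2 * c + 1)) UNIV" by (simp add: algebra_simps)
  hence th: "theta t = 2 * c + 1" by (simp add: theta_def infsumI)
  show "(?f has_sum theta t) UNIV" using H th by simp
  show "(\<lambda>n. 2 * exp (- pi * (real (Suc n))\<^sup>2 * t)) sums (theta t - 1)"
    using sums_mult[OF summable_sums[OF sm], of 2] by (simp add: th c_def)
qed

lemma theta_ge_1: "t > 0 \<Longrightarrow> theta t \<ge> 1"
  using sums_le[OF _ sums_zero theta_sums[of t]] by simp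

text \<open>From \<open>k\<^sup>2 \<ge> k\<close>, the series is at most the geometric one, with sum \<open>2 / (e\<^bsup>\<pi>t\<^esup> - 1)\<close>. One inequality of
  this shape covers both ends: \<open>j = 1\<close> bounds the growth at \<open>0\<close>, large \<open>j\<close> the decay at infinity.\<close>

lemma theta_minus_one_le:
  assumes "t > 0" "j \<ge> 1"
  shows "theta t - 1 \<le> 2 * fact j / (pi * t) ^ j"
proof -
  let ?q = "exp (- pi * t)"
  have q: "0 < ?q" "?q < 1" using assms by auto
  have "(\<lambda>n. ?q ^ n) sums (1 / (1 - ?q))" using q by (intro geometric_sums) auto
  from sums_mult[OF this, of "2 * ?q"]
  have "(\<lambda>n. 2 * ?q ^ Suc n) sums (2 * ?q / (1 - ?q))"
    by (simp add: mult.assoc)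
  note geo = this
  have "theta t - 1 \<le> 2 * ?q / (1 - ?q)"
    by (rule sums_le[OF _ theta_sums[OF assms(1)] geo])
       (use theta_term_le_geometric[of t] assms in auto)
  also have "\<dots> = 2 / (exp (pi * t) - 1)"
    using q assms by (simp add: exp_minus field_simps)
  also have "\<dots> \<le> 2 / ((pi * t) ^ j / fact j)"
    using exp_minus_one_ge[of "pi * t" j] assms by (intro divide_left_mono) auto
  finally show ?thesis by simp
qed

lemma theta_minus_one_le_inverse:
  assumes "t > 0"
  shows "theta t - 1 \<le> 1 / t" "theta t - 1 \<le> 1 / t\<^sup>2"
proof -
  have pi2: "pi > 2" using pi_gt3 by simp
  have "theta t - 1 \<le> 2 / (pi * t)" using theta_minus_one_le[of t 1] assms by simp
  also have "\<dots> \<le> 1 / t" using pi2 assms by (simp add: field_simps)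
  finally show "theta t - 1 \<le> 1 / t" .
  have "theta t - 1 \<le> 4 / (pi * t)\<^sup>2" using theta_minus_one_le[of t 2] assms by simp
  also have "\<dots> = (2 / pi)\<^sup>2 * (1 / t\<^sup>2)" by (simp add: power_mult_distrib power_divide)
  also have "\<dots> \<le> 1 * (1 / t\<^sup>2)"
    using pi2 by (intro mult_right_mono power_le_one) (auto simp: field_simps)
  finally show "theta t - 1 \<le> 1 / t\<^sup>2" by simp
qed

lemma continuous_on_theta: "continuous_on {0<..} theta"
proof -
  have "isCont theta t" if "t > 0" for t
  proof -
    define c where "c = t / 2"
    have c: "c > 0" using that by (simp add: c_def)
    let ?f = "\<lambda>n x. 2 * exp (- pi * (real (Suc n))\<^sup>2 * x)"
    have "uniform_limit {c<..} (\<lambda>n x. \<Sum>i<n. ?f i x) (\<lambda>x. \<Sum>i. ?f i x) sequentially"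
    proof (rule Weierstrass_m_test)
      show "summable (\<lambda>n. ?f n c)" using theta_sums[OF c] by (rule sums_summable)
      show "norm (?f n x) \<le> ?f n c" if "x \<in> {c<..}" for n x
        using that by (auto intro!: mult_left_mono)
    qed
    hence "continuous_on {c<..} (\<lambda>x. \<Sum>i. ?f i x)"
      by (rule uniform_limit_theorem[rotated]) (auto intro!: continuous_intros always_eventually)
    hence "continuous_on {c<..} (\<lambda>x. 1 + (\<Sum>i. ?f i x))"
      by (intro continuous_intros)
    also have "?this \<longleftrightarrow> continuous_on {c<..} theta"
    proof (rule continuous_on_cong)
      fix x assume "x \<in> {c<..}"
      hence "x > 0" using c by auto
      from sums_unique[OF theta_sums[OF this]] show "1 + (\<Sum>i. ?f i x) = theta x" by simp
    qed simp
    finally show ?thesis using that by (simp add: continuous_on_eq_continuous_at c_def)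
  qed
  thus ?thesis by (simp add: continuous_on_eq_continuous_at)
qed

lemma continuous_on_theta_compose [continuous_intros]:
  assumes "continuous_on S f" "\<And>x. x \<in> S \<Longrightarrow> f x > 0"
  shows "continuous_on S (\<lambda>x. theta (f x))"
  using continuous_on_compose2[OF continuous_on_theta assms(1)] assms(2) by auto

section \<open>The inversion formula\<close>

lemma integral_cos_int:
  fixes m :: int
  shows "((\<lambda>u. cos (2 * pi * real_of_int m * u)) has_integral (if m = 0 then 1 else 0)) {0..1}"
proof (cases "m = 0")
  case True
  thus ?thesis using has_integral_const_real[of "1::real" 0 1] by simp
next
  case False
  have "((\<lambda>u. cos (2 * pi * real_of_int m * u)) has_integral
      (sin (2 * pi * real_of_int m * 1) / (2 * pi * real_of_int m) -
       sin (2 * pi * real_of_int m * 0) / (2 * pi * real_of_int m))) {0..1}"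
    using False
    by (intro fundamental_theorem_of_calculus)
       (auto intro!: derivative_eq_intros simp flip: has_real_derivative_iff_has_vector_derivative)
  moreover have "sin (2 * pi * real_of_int m * 1) = 0"
    using sin_int_2pin[of m] by simp
  ultimately show ?thesis using False by simp
qed

text \<open>A symmetric continuous function on the unit interval is a continuous function \<open>H\<close> of
  \<open>sin\<^sup>2 (\<pi> u)\<close>, hence a uniform limit of Bernstein polynomials in that expression. If all cosine
  coefficients vanish, it is orthogonal to these polynomials, hence to itself. The symmetry
  reduces the problem to polynomial approximation on \<open>[0, 1]\<close>; no convergence of Fourier series is used.\<close>

lemma fourier_cos_uniqueness:
  fixes h :: "real \<Rightarrow> real"
  assumes cont: "continuous_on {0..1} h"
    and sym: "\<And>u. u \<in> {0..1} \<Longrightarrow> h (1 - u) = h u"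
    and zero: "\<And>k::int. integral {0..1} (\<lambda>u. h u * cos (2 * pi * k * u)) = 0"
    and u: "u \<in> {0..1}"
  shows "h u = 0"
proof -
  define s where "s = (\<lambda>u::real. (sin (pi * u))\<^sup>2)"
  have s_cos: "s u = (1 - cos (2 * pi * u)) / 2" for u
    using cos_double_sin[of "pi * u"] by (simp add: s_def algebra_simps)
  have conts [continuous_intros]: "continuous_on A s" for A
    unfolding s_def by (intro continuous_intros)
  have s01: "s u \<in> {0..1}" for u
    unfolding s_def using abs_sin_le_one[of "pi * u"] by (auto simp: abs_square_le_1)
  have int: "f integrable_on {0..1}" if "continuous_on {0..1} f" for f :: "real \<Rightarrow> real"
    using that by (rule integrable_continuous_real)
  \<comment> \<open>Multiplication by \<open>s\<close> preserves the vanishing of all cosine coefficients.\<close>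
  have mult_s: "integral {0..1} (\<lambda>u. q u * s u * cos (2 * pi * k * u)) = 0"
    if q: "continuous_on {0..1} q" "\<And>k::int. integral {0..1} (\<lambda>u. q u * cos (2 * pi * k * u)) = 0"
    for q :: "real \<Rightarrow> real" and k :: int
  proof -
    let ?c = "\<lambda>k::int. \<lambda>u. q u * cos (2 * pi * real_of_int k * u)"
    have eq: "q u * s u * cos (2 * pi * real_of_int k * u) = 1/2 * ?c k u - 1/4 * ?c (k+1) u - 1/4 * ?c (k-1) u" for u
    proof -
      have "cos (2 * pi * u) * cos (2 * pi * real_of_int k * u) =
          (cos (2 * pi * real_of_int (k+1) * u) + cos (2 * pi * real_of_int (k-1) * u)) / 2"
        using cos_times_cos[of "2 * pi * real_of_int k * u" "2 * pi * u"]
        by (simp add: algebra_simps)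
      moreover have "Q * ((1 - A) / 2) * B = 1/2 * (Q * B) - 1/4 * (Q * C) - 1/4 * (Q * D)"
        if "A * B = (C + D) / 2" for A B C D Q :: real
      proof -
        have "Q * ((1 - A) / 2) * B = 1/2 * (Q * B) - 1/2 * (Q * (A * B))" by (simp add: field_simps)
        thus ?thesis unfolding that by (simp add: field_simps)
      qed
      ultimately show ?thesis unfolding s_cos by blast
    qed
    have J: "(?c j has_integral 0) {0..1}" for j
    proof -
      have "continuous_on {0..1} (?c j)" by (intro continuous_intros q(1))
      from integrable_integral[OF int[OF this]] show ?thesis by (simp only: q(2))
    qed
    have "((\<lambda>u. 1/2 * ?c k u - 1/4 * ?c (k+1) u - 1/4 * ?c (k-1) u) has_integral (1/2 * 0 - 1/4 * 0 - 1/4 * 0)) {0..1}"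
      by (intro has_integral_diff has_integral_mult_right J)
    thus ?thesis unfolding eq by (simp add: integral_unique)
  qed
  have pow: "integral {0..1} (\<lambda>u. h u * s u ^ i * (1 - s u) ^ j * cos (2 * pi * k * u)) = 0" for i j :: nat and k :: int
  proof (induction j arbitrary: k)
    case 0
    have "integral {0..1} (\<lambda>u. h u * s u ^ i * cos (2 * pi * k * u)) = 0" for k :: int
    proof (induction i arbitrary: k)
      case (Suc i)
      have c: "continuous_on {0..1} (\<lambda>u. h u * s u ^ i)" by (intro continuous_intros cont)
      show ?case using mult_s[OF c Suc, of k] by (simp add: mult_ac)
    qed (simp add: zero)
    thus ?case by simp
  next
    case (Suc j)
    let ?q = "\<lambda>u. h u * s u ^ i * (1 - s u) ^ j"
    have c: "continuous_on {0..1} ?q" by (intro continuous_intros cont)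
    have "integral {0..1} (\<lambda>u. ?q u * cos (2 * pi * k * u) - ?q u * s u * cos (2 * pi * k * u)) = 0"
      by (subst integral_diff) (auto intro!: int continuous_intros cont simp: Suc mult_s[OF c Suc])
    thus ?case by (simp add: algebra_simps)
  qed
  have bern: "integral {0..1} (\<lambda>u. h u * (\<Sum>k\<le>n. a k * Bernstein n k (s u))) = 0" for n and a :: "nat \<Rightarrow> real"
  proof -
    have "integral {0..1} (\<lambda>u. h u * (\<Sum>k\<le>n. a k * Bernstein n k (s u))) =
        integral {0..1} (\<lambda>u. \<Sum>k\<le>n. (a k * (n choose k)) * (h u * s u ^ k * (1 - s u) ^ (n - k) * cos (2 * pi * (0::int) * u)))"
      by (simp add: Bernstein_def sum_distrib_left mult_ac)
    also have "\<dots> = (\<Sum>k\<le>n. integral {0..1} (\<lambda>u. (a k * (n choose k)) * (h u * s u ^ k * (1 - s u) ^ (n - k) * cos (2 * pi * (0::int) * u))))"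
      by (intro integral_sum int continuous_intros cont) auto
    also have "\<dots> = 0" by (simp only: integral_mult_right pow) simp
    finally show ?thesis .
  qed
  \<comment> \<open>On \<open>[0, 1/2]\<close> the map \<open>s\<close> is injective with inverse \<open>arcsin (sqrt x) / \<pi>\<close>.\<close>
  define H where "H = (\<lambda>x. h (arcsin (sqrt x) / pi))"
  have arc: "arcsin (sqrt x) / pi \<in> {0..1/2}" if "x \<in> {0..1}" for x
  proof -
    have "0 \<le> sqrt x" "sqrt x \<le> 1" using that by auto
    moreover from this have "-1 \<le> sqrt x" by linarith
    ultimately show ?thesis
      using arcsin_bounded[of "sqrt x"] arcsin_le_arcsin[of 0 "sqrt x"] by (auto simp: field_simps)
  qed
  have contH: "continuous_on {0..1} H"
    unfolding H_def
  proof (rule continuous_on_compose2[OF cont])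
    have "-1 \<le> sqrt x" "sqrt x \<le> 1" if "x \<in> {0..1}" for x :: real
      using that order_trans[of "-1" 0 "sqrt x"] by auto
    thus "continuous_on {0..1} (\<lambda>x. arcsin (sqrt x) / pi)"
      by (intro continuous_intros) auto
    show "(\<lambda>x. arcsin (sqrt x) / pi) ` {0..1} \<subseteq> {0..1}"
    proof safe
      fix x :: real assume "x \<in> {0..1}"
      from arc[OF this] show "arcsin (sqrt x) / pi \<in> {0..1}"
        unfolding atLeastAtMost_iff by linarith
    qed
  qed
  have Hs: "H (s u) = h u" if "u \<in> {0..1}" for u
  proof -
    have *: "H (s u) = h u" if "u \<in> {0..1/2}" for u
    proof -
      have "sin (pi * u) \<ge> 0" using that by (intro sin_ge_zero) auto
      hence "sqrt (s u) = sin (pi * u)" by (simp add: s_def)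
      moreover have "0 \<le> pi * u" "pi * u \<le> pi * (1/2)" using that by (auto intro!: mult_left_mono)
      hence "- (pi/2) \<le> pi * u" "pi * u \<le> pi / 2" using pi_gt_zero by linarith+
      ultimately show ?thesis by (simp add: H_def arcsin_sin)
    qed
    show ?thesis
    proof (cases "u \<le> 1/2")
      case False
      have "s (1 - u) = s u" by (simp add: s_def algebra_simps sin_diff)
      with *[of "1 - u"] sym[OF that] that False show ?thesis by simp
    qed (use * that in auto)
  qed
  obtain B where B: "B > 0" "\<And>u. u \<in> {0..1} \<Longrightarrow> \<bar>h u\<bar> \<le> B"
  proof -
    have "bounded (h ` {0..1})"
      by (intro compact_imp_bounded compact_continuous_image cont) auto
    thus ?thesis using that by (auto simp: bounded_pos)
  qed
  have "integral {0..1} (\<lambda>u. h u * h u) \<le> B * e" if e: "e > 0" for e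
  proof -
    obtain n where n: "\<And>x. x \<in> {0..1} \<Longrightarrow> \<bar>H x - (\<Sum>k\<le>n. H (k/n) * Bernstein n k x)\<bar> < e"
      using Bernstein_Weierstrass[OF contH e] by blast
    let ?p = "\<lambda>u. \<Sum>k\<le>n. H (k/n) * Bernstein n k (s u)"
    have cp: "continuous_on {0..1} ?p"
      unfolding Bernstein_def by (intro continuous_intros)
    have "integral {0..1} (\<lambda>u. h u * h u) = integral {0..1} (\<lambda>u. h u * h u) - integral {0..1} (\<lambda>u. h u * ?p u)"
      by (simp only: bern)
    also have "\<dots> = integral {0..1} (\<lambda>u. h u * h u - h u * ?p u)"
      by (intro integral_diff[symmetric] int continuous_intros cont cp)
    also have "\<dots> \<le> integral {0..1} (\<lambda>u::real. B * e)"
    proof (rule Henstock_Kurzweil_Integration.integral_le)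
      show "(\<lambda>u. h u * h u - h u * ?p u) integrable_on {0..1}"
        by (intro int continuous_intros cont cp)
      show "(\<lambda>u::real. B * e) integrable_on {0..1}" by (intro int continuous_intros)
      fix u :: real assume u: "u \<in> {0..1}"
      have "h u * h u - h u * ?p u = h u * (H (s u) - ?p u)"
        using Hs[OF u] by (simp add: algebra_simps)
      also have "\<dots> \<le> \<bar>h u\<bar> * \<bar>H (s u) - ?p u\<bar>" by (simp add: abs_mult[symmetric])
      also have "\<dots> \<le> B * e" using B(2)[OF u] n[OF s01] B(1) by (intro mult_mono) (auto simp: less_imp_le)
      finally show "h u * h u - h u * ?p u \<le> B * e" .
    qed
    finally show ?thesis by simp
  qed
  note small = this
  have "integral {0..1} (\<lambda>u. h u * h u) \<le> 0"
  proof (rule ccontr)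
    assume "\<not> ?thesis"
    hence "integral {0..1} (\<lambda>u. h u * h u) / (2 * B) > 0" using B(1) by simp
    from small[OF this] \<open>\<not> ?thesis\<close> show False using B(1) by (simp add: field_simps)
  qed
  moreover have "integral {0..1} (\<lambda>u. h u * h u) \<ge> 0"
    by (intro integral_nonneg int continuous_intros cont) auto
  ultimately have "integral {0..1} (\<lambda>u. h u * h u) = 0" by simp
  moreover have "continuous_on {0..1} (\<lambda>u. h u * h u)" by (intro continuous_intros cont)
  ultimately have "\<forall>u\<in>{0..1}. h u * h u = 0"
    by (subst (asm) integral_eq_0_iff) simp_all
  hence "h u * h u = 0" using u by blast
  thus ?thesis by simp
qed

lemma gaussian_integrable:
  assumes "x > (0::real)"
  shows "integrable lborel (\<lambda>v. exp (- pi * v\<^sup>2 * x))"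
proof -
  have "integrable lborel std_normal_density" by (rule integrable_normal_density) simp
  from lborel_integrable_real_affine[OF this, of "sqrt (2 * pi * x)" 0]
  have "integrable lborel (\<lambda>v. std_normal_density (sqrt (2 * pi * x) * v))" using assms by simp
  hence "integrable lborel (\<lambda>v. sqrt (2 * pi) * std_normal_density (sqrt (2 * pi * x) * v))"
    by simp
  also have "(\<lambda>v. sqrt (2 * pi) * std_normal_density (sqrt (2 * pi * x) * v)) = (\<lambda>v. exp (- pi * v\<^sup>2 * x))"
    using assms by (auto simp: std_normal_density_def power_mult_distrib field_simps)
  finally show ?thesis .
qed

text \<open>The Fourier transform of the Gaussian is the characteristic function of the standard
  normal distribution, up to the scaling \<open>w = sqrt (2 \<pi> x) v\<close>.\<close>

lemma gaussian_cos_integral: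
  assumes "x > (0::real)"
  shows "(LBINT v. exp (- pi * v\<^sup>2 * x) * cos (2 * pi * k * v)) = exp (- pi * k\<^sup>2 / x) / sqrt x"
proof -
  define t where "t = 2 * pi * k / sqrt (2 * pi * x)"
  have "exp (- t\<^sup>2 / 2) = Re (char std_normal_distribution t)"
    by (simp add: char_std_normal_distribution)
  also have "char std_normal_distribution t = (LINT w|std_normal_distribution. iexp (t * w))"
    by (simp add: char_def)
  also have "\<dots> = (LBINT w. std_normal_density w *\<^sub>R iexp (t * w))"
    by (subst integral_density) auto
  also have "Re \<dots> = (LBINT w. Re (std_normal_density w *\<^sub>R iexp (t * w)))"
  proof (rule integral_Re[symmetric])
    show "integrable lborel (\<lambda>w. std_normal_density w *\<^sub>R iexp (t * w))"
      by (rule Bochner_Integration.integrable_bound[of _ std_normal_density])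
         (auto intro!: integrable_normal_density)
  qed
  also have "\<dots> = (LBINT w. std_normal_density w * cos (t * w))"
    by (simp add: Re_exp)
  also have "\<dots> = sqrt (2 * pi * x) * (LBINT v. std_normal_density (sqrt (2 * pi * x) * v) * cos (t * (sqrt (2 * pi * x) * v)))"
    using assms by (subst lborel_integral_real_affine[where c = "sqrt (2 * pi * x)" and t = 0]) auto
  also have "\<dots> = (LBINT v. sqrt (2 * pi * x) * (std_normal_density (sqrt (2 * pi * x) * v) * cos (t * (sqrt (2 * pi * x) * v))))"
    by simp
  also have "\<dots> = (LBINT v. sqrt x * (exp (- pi * v\<^sup>2 * x) * cos (2 * pi * k * v)))"
    using assms
    by (intro Bochner_Integration.integral_cong refl)
       (simp add: std_normal_density_def power_mult_distrib real_sqrt_mult t_def mult_ac)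
  also have "\<dots> = sqrt x * (LBINT v. exp (- pi * v\<^sup>2 * x) * cos (2 * pi * k * v))" by simp
  finally have fin: "exp (- t\<^sup>2 / 2) = sqrt x * (LBINT v. exp (- pi * v\<^sup>2 * x) * cos (2 * pi * k * v))" .
  have "(LBINT v. exp (- pi * v\<^sup>2 * x) * cos (2 * pi * k * v)) = exp (- t\<^sup>2 / 2) / sqrt x"
    unfolding fin using assms by simp
  also have "- t\<^sup>2 / 2 = - pi * k\<^sup>2 / x"
  proof -
    have "(sqrt (2 * pi * x))\<^sup>2 = 2 * pi * x" using assms by (intro real_sqrt_pow2) auto
    hence "t\<^sup>2 = (2 * pi * k)\<^sup>2 / (2 * pi * x)"
      unfolding t_def power_divide by (simp only:)
    also have "\<dots> = (2 * pi) * (2 * pi * k\<^sup>2) / ((2 * pi) * x)"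
      by (simp only: power2_eq_square mult_ac)
    also have "\<dots> = 2 * pi * k\<^sup>2 / x"
      by (subst mult_divide_mult_cancel_left) auto
    finally show ?thesis by simp
  qed
  finally show ?thesis .
qed

lemma set_integral_translate_unit:
  fixes G :: "real \<Rightarrow> real"
  shows "(LBINT v:{c..<c+1}. G v) = (LBINT u:{0..<1}. G (c + u))"
proof -
  have "(LBINT v:{c..<c+1}. G v) = (LBINT u. indicator {c..<c+1} (c + 1 * u) *\<^sub>R G (c + 1 * u))"
    unfolding set_lebesgue_integral_def by (subst lborel_integral_real_affine[of 1 _ c]) auto
  also have "\<dots> = (LBINT u:{0..<1}. G (c + u))"
    unfolding set_lebesgue_integral_def
    by (intro Bochner_Integration.integral_cong) (auto simp: indicator_def)
  finally show ?thesis .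
qed

text \<open>Cutting the line at the integers is the unfolding step of Poisson summation.\<close>

lemma integral_line_eq_sum_unit_intervals:
  fixes G :: "real \<Rightarrow> real"
  assumes "integrable lborel G"
  shows "((\<lambda>n::int. LBINT u:{0..<1}. G (real_of_int n + u)) has_sum (LBINT v. G v)) UNIV"
proof -
  let ?f = "\<lambda>(n::int) v. indicator {real_of_int n..<real_of_int n+1} v * G v"
  have single: "((\<lambda>n. ?f n v) has_sum G v) UNIV" "((\<lambda>n. norm (?f n v)) has_sum norm (G v)) UNIV" for v
    by (rule has_sum_single[where a = "\<lfloor>v\<rfloor>"]; force simp: indicator_def floor_unique)+
  have "((\<lambda>n. LBINT v:UNIV. ?f n v) has_sum (LBINT v:UNIV. (\<Sum>\<^sub>\<infinity>n. ?f n v))) UNIV"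
  proof (rule has_sum_set_integral)
    show "set_integrable lborel UNIV (?f n)" for n
      using integrable_real_mult_indicator[OF _ assms, of "{real_of_int n..<real_of_int n+1}"]
      by (simp add: set_integrable_def mult.commute)
    show "set_integrable lborel UNIV (\<lambda>v. norm (G v))"
      using assms by (simp add: set_integrable_def)
    show "((\<lambda>n. norm (?f n v)) has_sum norm (G v)) UNIV" for v by (rule single)
  qed
  moreover have "(\<Sum>\<^sub>\<infinity>n. ?f n v) = G v" for v
    using single(1) by (rule infsumI)
  moreover have "(LBINT v:UNIV. ?f n v) = (LBINT u:{0..<1}. G (real_of_int n + u))" for n
    unfolding set_integral_translate_unit[symmetric] by (simp add: set_lebesgue_integral_def)
  ultimately show ?thesis by (simp add: set_lebesgue_integral_def)
qed

lemma set_integral_unit_eq_integral: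
  fixes f :: "real \<Rightarrow> real"
  assumes "continuous_on {0..1} f"
  shows "(LBINT u:{0..<1}. f u) = integral {0..1} f" "set_integrable lborel {0..<1} f"
proof -
  have i: "set_integrable lborel {0..1} f"
    using borel_integrable_compact[OF _ assms] by (simp add: set_integrable_def indicator_scaleR_eq_if)
  show "set_integrable lborel {0..<1} f" by (rule set_integrable_subset[OF i]) auto
  have "(LBINT u:{0..<1}. f u) = (LBINT u:{0..1}. f u)"
  proof (rule set_integral_cong_set)
    show "set_borel_measurable lborel {0..<1} f" "set_borel_measurable lborel {0..1} f"
      using \<open>set_integrable lborel {0..<1} f\<close> i
      by (auto simp: set_borel_measurable_def set_integrable_def)
    show "AE u in lborel. (u \<in> {0..1}) = (u \<in> {0..<1::real})"
      using AE_lborel_singleton[of "1::real"] by eventually_elim auto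
  qed
  also have "\<dots> = integral {0..1} f" using i by (rule set_borel_integral_eq_integral)
  finally show "(LBINT u:{0..<1}. f u) = integral {0..1} f" .
qed

text \<open>For \<open>u\<close> in the unit interval the point \<open>n + u\<close> is farther from the origin than one of its
  two integer neighbours, which gives a majorant independent of \<open>u\<close>.\<close>

lemma gaussian_periodization_summable:
  assumes "x > (0::real)"
  defines "M \<equiv> \<lambda>n::int. exp (- pi * (real_of_int n)\<^sup>2 * x) + exp (- pi * (real_of_int (n + 1))\<^sup>2 * x)"
  shows "M summable_on UNIV"
    and "u \<in> {0..1} \<Longrightarrow> exp (- pi * (real_of_int n + u)\<^sup>2 * x) \<le> M n"
proof -
  let ?f = "\<lambda>k::int. exp (- pi * (real_of_int k)\<^sup>2 * x)"
  have s: "?f summable_on UNIV" using theta_has_sum[OF assms(1)] by (rule has_sum_imp_summable)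
  have "(\<lambda>k. ?f (k + 1)) summable_on UNIV"
    using summable_on_reindex_bij_betw[of "\<lambda>k::int. k + 1" UNIV UNIV ?f] s
    by (simp add: bij_plus_right)
  with s show "M summable_on UNIV" unfolding M_def by (rule summable_on_add)
  assume u: "u \<in> {0..1}"
  show "exp (- pi * (real_of_int n + u)\<^sup>2 * x) \<le> M n"
  proof (cases "n \<ge> 0")
    case True
    hence "(real_of_int n)\<^sup>2 \<le> (real_of_int n + u)\<^sup>2" using u by (intro power_mono) auto
    hence "exp (- pi * (real_of_int n + u)\<^sup>2 * x) \<le> ?f n" using assms by simp
    thus ?thesis unfolding M_def using exp_ge_zero[of "- pi * (real_of_int (n + 1))\<^sup>2 * x"] by linarith
  next
    case False
    hence "n + 1 \<le> 0" by simp
    hence "real_of_int (n + 1) \<le> 0" by (simp only: of_int_le_0_iff)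
    hence "(- real_of_int (n + 1))\<^sup>2 \<le> (- (real_of_int n + u))\<^sup>2" using u by (intro power_mono) auto
    hence "(real_of_int (n + 1))\<^sup>2 \<le> (real_of_int n + u)\<^sup>2" by (simp only: power2_minus)
    hence "exp (- pi * (real_of_int n + u)\<^sup>2 * x) \<le> ?f (n + 1)" using assms by simp
    thus ?thesis unfolding M_def using exp_ge_zero[of "- pi * (real_of_int n)\<^sup>2 * x"] by linarith
  qed
qed

text \<open>Poisson summation. The periodized Gaussian \<open>f\<close> and the absolutely convergent cosine series
  \<open>g\<close> formed with its Fourier coefficients have the same coefficients, so they agree, and
  the value at \<open>0\<close> is the claim.\<close>

theorem theta_inversion:
  assumes "x > 0"
  shows "theta (1 / x) = sqrt x * theta x"
proof -
  let ?M = "\<lambda>n::int. exp (- pi * (real_of_int n)\<^sup>2 * x) + exp (- pi * (real_of_int (n + 1))\<^sup>2 * x)"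
  note M = gaussian_periodization_summable[OF assms]
  define G where "G = (\<lambda>(k::int) v::real. exp (- pi * v\<^sup>2 * x) * cos (2 * pi * k * v))"
  define f where "f = (\<lambda>u::real. \<Sum>\<^sub>\<infinity>n::int. exp (- pi * (real_of_int n + u)\<^sup>2 * x))"
  define c where "c = (\<lambda>k::int. exp (- pi * (real_of_int k)\<^sup>2 / x) / sqrt x)"
  define g where "g = (\<lambda>u::real. \<Sum>\<^sub>\<infinity>j::int. c j * cos (2 * pi * j * u))"
  have contf: "continuous_on {0..1} f"
    unfolding f_def by (rule continuous_on_infsum[where M = ?M]) (use M in \<open>auto intro!: continuous_intros\<close>)
  have c_sum: "(c has_sum theta (1 / x) / sqrt x) UNIV"
    unfolding c_def using has_sum_divide_const[OF theta_has_sum[of "1 / x"]] assms by simp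
  have c_nonneg: "c j \<ge> 0" for j unfolding c_def using assms by simp
  have c_bound: "norm (c j * cos (2 * pi * j * u)) \<le> c j" for j :: int and u :: real
    using c_nonneg[of j] abs_cos_le_one[of "2 * pi * j * u"] by (simp add: abs_mult mult_left_le)
  have contg: "continuous_on {0..1} g"
    unfolding g_def by (rule continuous_on_infsum[where M = c])
      (use c_bound has_sum_imp_summable[OF c_sum] in \<open>auto intro!: continuous_intros\<close>)
  have f_sum: "((\<lambda>n::int. exp (- pi * (real_of_int n + u)\<^sup>2 * x)) has_sum f u) UNIV" if "u \<in> {0..1}" for u
    unfolding f_def
    by (intro has_sum_infsum summable_on_comparison_test[OF M(1)]) (use M(2)[OF that] in auto)
  have g_sum: "((\<lambda>j::int. c j * cos (2 * pi * j * u)) has_sum g u) UNIV" for u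
    unfolding g_def
    by (intro has_sum_infsum abs_summable_summable[OF summable_on_comparison_test[OF has_sum_imp_summable[OF c_sum]]])
       (use c_bound in auto)
  have f_sym: "f (1 - u) = f u" for u
    unfolding f_def
    by (rule infsum_reindex_bij_witness[of UNIV "\<lambda>n. - n - 1" "\<lambda>n. - n - 1"])
       (auto simp: power2_eq_square algebra_simps)
  have g_sym: "g (1 - u) = g u" for u
  proof -
    have "cos (2 * pi * real_of_int j * (1 - u)) = cos (2 * pi * real_of_int j * u)" for j
      using cos_int_2pin[of j] sin_int_2pin[of j] by (simp add: algebra_simps cos_diff)
    thus ?thesis by (simp add: g_def)
  qed
  \<comment> \<open>Unfolding: \<open>cos (2 \<pi> k u)\<close> has period \<open>1\<close>, so the integral over the unit interval is one over the line.\<close>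
  have f_coeff: "integral {0..1} (\<lambda>u. f u * cos (2 * pi * k * u)) = c k" for k :: int
  proof -
    have G_int: "integrable lborel (G k)"
      unfolding G_def
      by (rule Bochner_Integration.integrable_bound[OF gaussian_integrable[OF assms]])
         (auto simp: abs_mult intro!: AE_I2 mult_left_le)
    have G_shift: "G k (real_of_int n + u) = exp (- pi * (real_of_int n + u)\<^sup>2 * x) * cos (2 * pi * k * u)" for n u
      using cos_int_2pin[of "k * n"] sin_int_2pin[of "k * n"] by (simp add: G_def algebra_simps cos_add)
    have "((\<lambda>n::int. LBINT u:{0..<1}. G k (real_of_int n + u)) has_sum
        (LBINT u:{0..<1}. (\<Sum>\<^sub>\<infinity>n::int. G k (real_of_int n + u)))) UNIV"
    proof (rule has_sum_set_integral)
      show "set_integrable lborel {0..<1} (\<lambda>u. G k (real_of_int n + u))" for n :: int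
        unfolding G_def by (intro set_integral_unit_eq_integral(2) continuous_intros)
      show "set_integrable lborel {0..<1} (\<lambda>u. f u * \<bar>cos (2 * pi * k * u)\<bar>)"
        by (intro set_integral_unit_eq_integral(2) continuous_intros contf)
      show "((\<lambda>n. norm (G k (real_of_int n + u))) has_sum f u * \<bar>cos (2 * pi * k * u)\<bar>) UNIV"
        if "u \<in> {0..<1}" for u
        using has_sum_cmult_left[OF f_sum[of u], of "\<bar>cos (2 * pi * k * u)\<bar>"] that
        by (simp add: G_shift abs_mult)
    qed
    also have "(LBINT u:{0..<1}. (\<Sum>\<^sub>\<infinity>n::int. G k (real_of_int n + u))) = (LBINT u:{0..<1}. f u * cos (2 * pi * k * u))"
      by (intro set_lebesgue_integral_cong)
         (auto simp: G_shift intro!: infsumI has_sum_cmult_left f_sum[simplified])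
    also have "\<dots> = integral {0..1} (\<lambda>u. f u * cos (2 * pi * k * u))"
      by (intro set_integral_unit_eq_integral(1) continuous_intros contf)
    finally have "integral {0..1} (\<lambda>u. f u * cos (2 * pi * k * u)) = (LBINT v. G k v)"
      using integral_line_eq_sum_unit_intervals[OF G_int] by (rule has_sum_unique)
    thus ?thesis unfolding G_def c_def using gaussian_cos_integral[OF assms, of k] by simp
  qed
  have g_coeff: "integral {0..1} (\<lambda>u. g u * cos (2 * pi * k * u)) = c k" for k :: int
  proof -
    let ?h = "\<lambda>(j::int) u::real. c j * cos (2 * pi * j * u) * cos (2 * pi * k * u)"
    have "((\<lambda>j. LBINT u:{0..<1}. ?h j u) has_sum (LBINT u:{0..<1}. (\<Sum>\<^sub>\<infinity>j. ?h j u))) UNIV"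
    proof (rule has_sum_set_integral)
      show "set_integrable lborel {0..<1} (?h j)" for j
        by (intro set_integral_unit_eq_integral(2) continuous_intros)
      have sm: "(\<lambda>j. norm (?h j u)) summable_on UNIV" for u
      proof (rule summable_on_comparison_test[OF has_sum_imp_summable[OF c_sum]])
        show "norm (?h j u) \<le> c j" for j
          using mult_mono[OF c_bound[of j u] abs_cos_le_one[of "2 * pi * k * u"]] c_nonneg[of j]
          by (simp add: abs_mult)
      qed auto
      show "((\<lambda>j. norm (?h j u)) has_sum (\<Sum>\<^sub>\<infinity>j. norm (?h j u))) UNIV" for u
        using sm by simp
      have bnd: "norm (norm (?h j u)) \<le> c j" for j u
        using mult_mono[OF c_bound[of j u] abs_cos_le_one[of "2 * pi * k * u"]] c_nonneg[of j]
        by (simp add: abs_mult)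
      show "set_integrable lborel {0..<1} (\<lambda>u. \<Sum>\<^sub>\<infinity>j. norm (?h j u))"
        by (intro set_integral_unit_eq_integral(2) continuous_on_infsum[where M = c])
           (use bnd has_sum_imp_summable[OF c_sum] in \<open>auto intro!: continuous_intros\<close>)
    qed
    also have "(LBINT u:{0..<1}. (\<Sum>\<^sub>\<infinity>j. ?h j u)) = (LBINT u:{0..<1}. g u * cos (2 * pi * k * u))"
      by (intro set_lebesgue_integral_cong) (auto intro!: infsumI has_sum_cmult_left g_sum)
    also have "\<dots> = integral {0..1} (\<lambda>u. g u * cos (2 * pi * k * u))"
      by (intro set_integral_unit_eq_integral(1) continuous_intros contg)
    also have "(\<lambda>j. LBINT u:{0..<1}. ?h j u) =
        (\<lambda>j. (if j = k then c k / 2 else 0) + (if j = - k then c k / 2 else 0))"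
    proof
      fix j :: int
      have "(LBINT u:{0..<1}. ?h j u) = integral {0..1} (?h j)"
        by (intro set_integral_unit_eq_integral(1) continuous_intros)
      also have "\<dots> = c j / 2 * (if j + k = 0 then 1 else 0) + c j / 2 * (if j - k = 0 then 1 else 0)"
      proof (rule integral_unique)
        have "?h j = (\<lambda>u. c j / 2 * cos (2 * pi * real_of_int (j + k) * u) + c j / 2 * cos (2 * pi * real_of_int (j - k) * u))"
          by (auto simp: cos_times_cos algebra_simps)
        thus "(?h j has_integral (c j / 2 * (if j + k = 0 then 1 else 0) + c j / 2 * (if j - k = 0 then 1 else 0))) {0..1}"
          by (simp only:) (intro has_integral_add has_integral_mult_right integral_cos_int)
      qed
      also have "\<dots> = (if j = k then c k / 2 else 0) + (if j = - k then c k / 2 else 0)"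
      proof -
        have "j + k = 0 \<longleftrightarrow> j = - k" "j - k = 0 \<longleftrightarrow> j = k" by auto
        moreover have "c (- k) = c k" by (simp add: c_def)
        ultimately show ?thesis by (cases "j = k"; cases "j = - k") auto
      qed
      finally show "(LBINT u:{0..<1}. ?h j u) = (if j = k then c k / 2 else 0) + (if j = - k then c k / 2 else 0)" .
    qed
    finally have "((\<lambda>j. (if j = k then c k / 2 else 0) + (if j = - k then c k / 2 else 0)) has_sum
        integral {0..1} (\<lambda>u. g u * cos (2 * pi * k * u))) UNIV" .
    moreover have "((\<lambda>j. (if j = k then c k / 2 else 0) + (if j = - k then c k / 2 else 0)) has_sum (c k / 2 + c k / 2)) UNIV"
      by (intro has_sum_add has_sum_single[where a = k] has_sum_single[where a = "- k"]) auto
    ultimately show ?thesis by (auto dest: has_sum_unique)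
  qed
  have "f 0 - g 0 = 0"
  proof (rule fourier_cos_uniqueness[where h = "\<lambda>u. f u - g u"])
    show "continuous_on {0..1} (\<lambda>u. f u - g u)" by (intro continuous_intros contf contg)
    show "f (1 - u) - g (1 - u) = f u - g u" for u by (simp only: f_sym g_sym)
    show "integral {0..1} (\<lambda>u. (f u - g u) * cos (2 * pi * k * u)) = 0" for k :: int
    proof -
      have "integral {0..1} (\<lambda>u. (f u - g u) * cos (2 * pi * k * u)) =
          integral {0..1} (\<lambda>u. f u * cos (2 * pi * k * u)) - integral {0..1} (\<lambda>u. g u * cos (2 * pi * k * u))"
        unfolding left_diff_distrib
        by (intro Henstock_Kurzweil_Integration.integral_diff integrable_continuous_real continuous_intros contf contg)
      thus ?thesis by (simp only: f_coeff g_coeff)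
    qed
  qed auto
  moreover have "f 0 = theta x" by (simp add: f_def theta_def)
  moreover have "g 0 = theta (1 / x) / sqrt x" using infsumI[OF c_sum] by (simp add: g_def)
  ultimately show ?thesis using assms by (simp add: field_simps)
qed

section \<open>Mellin convolution and Bessel functions\<close>

text \<open>The Mellin convolution of \<open>\<theta> - 1\<close> with itself. Under \<open>a = sqrt (\<nu> \<tau>)\<close> each half of the
  integral defining \<open>V\<close> becomes a value of this function; the factor \<open>1/2\<close> comes from
  \<open>da/a = d\<tau>/(2\<tau>)\<close>.\<close>

definition theta_conv :: "real \<Rightarrow> real" where
  "theta_conv y = (LBINT \<tau>:{0<..}. (theta (y * \<tau>) - 1) * (theta (y / \<tau>) - 1) / (2 * \<tau>))"

text \<open>At infinity one factor is bounded by a multiple of \<open>\<tau>\<^sup>-\<^sup>2\<close> and the other by a multiple of \<open>\<tau>\<close>; near \<open>0\<close> the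
  roles are exchanged.\<close>

lemma theta_conv_integrable:
  assumes y: "y > 0"
  shows "set_integrable lborel {0<..} (\<lambda>\<tau>. (theta (y * \<tau>) - 1) * (theta (y / \<tau>) - 1) / (2 * \<tau>))" (is "set_integrable _ _ ?f")
proof (rule set_integrable_split_at[of 1])
  have cont: "continuous_on S ?f" if "S \<subseteq> {0<..}" for S
    using that y by (intro continuous_intros) auto
  define C where "C = 1 / y ^ 3"
  show "set_integrable lborel {1..} ?f"
  proof (rule set_integrable_continuous_dominated)
    show "set_integrable lborel {1..} (\<lambda>\<tau>. C * \<tau> powr (-2))"
      by (intro set_integrable_mult_right set_integral_powr_to_inf(1)) auto
    fix \<tau> :: real assume "\<tau> \<in> {1..}"
    hence t: "\<tau> \<ge> 1" "\<tau> > 0" by auto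
    have nn: "theta (y * \<tau>) - 1 \<ge> 0" "theta (y / \<tau>) - 1 \<ge> 0"
      using theta_ge_1[of "y * \<tau>"] theta_ge_1[of "y / \<tau>"] y t by auto
    have "(theta (y * \<tau>) - 1) * (theta (y / \<tau>) - 1) \<le> (1 / (y * \<tau>)\<^sup>2) * (1 / (y / \<tau>))"
      by (intro mult_mono theta_minus_one_le_inverse) (use y t nn in auto)
    also have "\<dots> = C / \<tau>"
      using y t by (simp add: C_def power2_eq_square power3_eq_cube field_simps)
    finally have "?f \<tau> \<le> C / \<tau> / (2 * \<tau>)" using t by (intro divide_right_mono) auto
    also have "\<dots> \<le> C * \<tau> powr (-2)"
      using t y by (simp add: powr_minus powr_numeral power2_eq_square C_def field_simps)
    finally show "norm (?f \<tau>) \<le> C * \<tau> powr (-2)" using nn t by simp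
  qed (auto intro!: cont)
  show "set_integrable lborel {0<..1} ?f"
  proof (rule set_integrable_continuous_dominated)
    show "set_integrable lborel {0<..1} (\<lambda>\<tau>. C * \<tau> powr 0)"
      by (intro set_integrable_mult_right set_integral_powr_from_0(1)) auto
    fix \<tau> :: real assume "\<tau> \<in> {0<..1}"
    hence t: "\<tau> \<le> 1" "\<tau> > 0" by auto
    have nn: "theta (y * \<tau>) - 1 \<ge> 0" "theta (y / \<tau>) - 1 \<ge> 0"
      using theta_ge_1[of "y * \<tau>"] theta_ge_1[of "y / \<tau>"] y t by auto
    have "(theta (y * \<tau>) - 1) * (theta (y / \<tau>) - 1) \<le> (1 / (y * \<tau>)) * (1 / (y / \<tau>)\<^sup>2)"
      by (intro mult_mono theta_minus_one_le_inverse) (use y t nn in auto)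
    also have "\<dots> = C * \<tau>"
      using y t by (simp add: C_def power2_eq_square power3_eq_cube field_simps)
    finally have "?f \<tau> \<le> C * \<tau> / (2 * \<tau>)" using t by (intro divide_right_mono) auto
    also have "\<dots> \<le> C * \<tau> powr 0"
      using t y by (simp add: C_def field_simps)
    finally show "norm (?f \<tau>) \<le> C * \<tau> powr 0" using nn t by simp
  qed (auto intro!: cont)
qed auto

text \<open>The measure \<open>d\<tau>/\<tau>\<close> and the product of the two factors are invariant under \<open>\<tau> \<mapsto> 1/\<tau>\<close>.\<close>

lemma theta_conv_eq_half:
  assumes y: "y > 0"
  shows "theta_conv y = (LBINT \<tau>:{1..}. (theta (y * \<tau>) - 1) * (theta (y / \<tau>) - 1) / \<tau>)"
proof -
  let ?f = "\<lambda>\<tau>. (theta (y * \<tau>) - 1) * (theta (y / \<tau>) - 1) / (2 * \<tau>)"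
  have "theta_conv y = (LBINT \<tau>:{0<..1}. ?f \<tau>) + (LBINT \<tau>:{1..}. ?f \<tau>)"
    unfolding theta_conv_def by (rule set_integral_split_at[OF theta_conv_integrable[OF y]]) simp
  also have "(LBINT \<tau>:{0<..1}. ?f \<tau>) = (LBINT \<tau>:{1/1..}. ?f (1 / \<tau>) / \<tau>\<^sup>2)"
    using y by (intro set_integral_inversion_real continuous_intros) auto
  also have "\<dots> = (LBINT \<tau>:{1..}. ?f \<tau>)"
    unfolding div_by_1 by (intro set_lebesgue_integral_cong) (auto simp: power2_eq_square)
  also have "(LBINT \<tau>:{1..}. ?f \<tau>) + (LBINT \<tau>:{1..}. ?f \<tau>) = (LBINT \<tau>:{1..}. 2 * ?f \<tau>)"
    by (subst set_integral_mult_right) simp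
  also have "\<dots> = (LBINT \<tau>:{1..}. (theta (y * \<tau>) - 1) * (theta (y / \<tau>) - 1) / \<tau>)"
    by (intro set_lebesgue_integral_cong) auto
  finally show ?thesis .
qed

lemma V_fun_eq_theta_conv:
  assumes x: "x > 0" and \<nu>: "\<nu> > 0"
  shows "V_fun x \<nu> = theta_conv (\<nu> / x\<^sup>2) - x\<^sup>2 * theta_conv (\<nu> * x\<^sup>2)"
proof -
  define F where "F = (\<lambda>t a. (theta (a\<^sup>2 * t) - 1) * (theta ((\<nu> / a)\<^sup>2 * t) - 1) / a)"
  have F: "set_integrable lborel {0<..} (F t)" "(LBINT a:{0<..}. F t a) = theta_conv (\<nu> * t)"
    if t: "t > 0" for t
  proof -
    let ?f = "\<lambda>\<tau>. (theta (\<nu> * t * \<tau>) - 1) * (theta (\<nu> * t / \<tau>) - 1) / (2 * \<tau>)"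
    let ?h = "\<lambda>a. \<bar>2 * a / \<nu>\<bar> * ?f (a\<^sup>2 / \<nu>)"
    have cf: "continuous_on {0<..} ?f" using \<nu> t by (intro continuous_intros) auto
    have bij: "bij_betw (\<lambda>a. a\<^sup>2 / \<nu>) {0<..} {0<..}"
      by (rule bij_betw_byWitness[where f' = "\<lambda>\<tau>. sqrt (\<nu> * \<tau>)"]) (use \<nu> in auto)
    have der: "((\<lambda>a. a\<^sup>2 / \<nu>) has_field_derivative 2 * a / \<nu>) (at a within {0<..})" for a
      using \<nu> by (auto intro!: derivative_eq_intros)
    have cg: "continuous_on {0<..} (\<lambda>a. 2 * a / \<nu>)" using \<nu> by (intro continuous_intros) auto
    note cv = set_integral_change_of_variables_real[OF cf cg der bij]
    have eq: "?h a = F t a" if "a \<in> {0<..}" for a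
    proof -
      have "a > 0" using that by simp
      hence "\<nu> * t * (a\<^sup>2 / \<nu>) = a\<^sup>2 * t" "\<nu> * t / (a\<^sup>2 / \<nu>) = (\<nu> / a)\<^sup>2 * t"
        "\<bar>2 * a / \<nu>\<bar> / (2 * (a\<^sup>2 / \<nu>)) = 1 / a"
        using \<nu> by (auto simp: power2_eq_square field_simps)
      moreover have "?h a = (\<bar>2 * a / \<nu>\<bar> / (2 * (a\<^sup>2 / \<nu>))) *
          ((theta (\<nu> * t * (a\<^sup>2 / \<nu>)) - 1) * (theta (\<nu> * t / (a\<^sup>2 / \<nu>)) - 1))"
        by (simp only: times_divide_eq_right times_divide_eq_left)
      ultimately show ?thesis by (simp only: F_def) simp
    qed
    have "set_integrable lborel {0<..} ?f" using theta_conv_integrable[of "\<nu> * t"] \<nu> t by simp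
    hence "set_integrable lborel {0<..} ?h" using cv(1) by simp
    also have "?this \<longleftrightarrow> set_integrable lborel {0<..} (F t)"
      by (rule set_integrable_cong) (use eq in auto)
    finally show "set_integrable lborel {0<..} (F t)" .
    have "theta_conv (\<nu> * t) = (LBINT a:{0<..}. ?h a)"
      unfolding theta_conv_def using cv(2) by simp
    also have "\<dots> = (LBINT a:{0<..}. F t a)"
      by (rule set_lebesgue_integral_cong) (use eq in auto)
    finally show "(LBINT a:{0<..}. F t a) = theta_conv (\<nu> * t)" ..
  qed
  have "V_fun x \<nu> = (LBINT a:{0<..}. F (1 / x\<^sup>2) a - x\<^sup>2 * F (x\<^sup>2) a)"
    unfolding V_fun_def
    by (intro set_lebesgue_integral_cong) (auto simp: w_ab_def F_def diff_divide_distrib)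
  also have "\<dots> = (LBINT a:{0<..}. F (1 / x\<^sup>2) a) - (LBINT a:{0<..}. x\<^sup>2 * F (x\<^sup>2) a)"
    using x by (intro set_integral_diff set_integrable_mult_right F) auto
  also have "\<dots> = theta_conv (\<nu> / x\<^sup>2) - x\<^sup>2 * theta_conv (\<nu> * x\<^sup>2)"
    using x F(2)[of "1 / x\<^sup>2"] F(2)[of "x\<^sup>2"] by simp
  finally show ?thesis .
qed

text \<open>Substitute \<open>\<tau> = (n/m) e\<^sup>u\<close>, the point where both exponents balance: their sum becomes
  \<open>-2 \<pi> m n y cosh u\<close>, which is even in \<open>u\<close>.\<close>

lemma bessel_K_0_eq_theta_term:
  fixes m n y :: real
  assumes pos: "m > 0" "n > 0" "y > 0"
    and int: "set_integrable lborel {0<..} (\<lambda>\<tau>. exp (- pi * m\<^sup>2 * (y * \<tau>)) * exp (- pi * n\<^sup>2 * (y / \<tau>)) / (2 * \<tau>))"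
  shows "(LBINT \<tau>:{0<..}. exp (- pi * m\<^sup>2 * (y * \<tau>)) * exp (- pi * n\<^sup>2 * (y / \<tau>)) / (2 * \<tau>)) = bessel_K 0 (2 * pi * (m * n) * y)"
proof -
  let ?f = "\<lambda>\<tau>. exp (- pi * m\<^sup>2 * (y * \<tau>)) * exp (- pi * n\<^sup>2 * (y / \<tau>)) / (2 * \<tau>)"
  define z where "z = 2 * pi * (m * n) * y"
  define h where "h = (\<lambda>u. exp (- z * cosh u) / 2)"
  have bij: "bij_betw (\<lambda>u. n / m * exp u) UNIV {0<..}"
  proof (rule bij_betw_byWitness[where f' = "\<lambda>\<tau>. ln (m / n * \<tau>)"])
    show "\<forall>\<tau>\<in>{0<..}. n / m * exp (ln (m / n * \<tau>)) = \<tau>"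
    proof
      fix \<tau> :: real assume "\<tau> \<in> {0<..}"
      hence "exp (ln (m / n * \<tau>)) = m / n * \<tau>" using pos by (intro exp_ln) auto
      thus "n / m * exp (ln (m / n * \<tau>)) = \<tau>" using pos by simp
    qed
  qed (use pos in auto)
  have cf: "continuous_on {0<..} ?f" by (intro continuous_intros) auto
  have der: "((\<lambda>u. n / m * exp u) has_field_derivative n / m * exp u) (at u within UNIV)" for u
    using pos by (auto intro!: derivative_eq_intros)
  have cg: "continuous_on UNIV (\<lambda>u. n / m * exp u)" using pos by (intro continuous_intros) auto
  note cv = set_integral_change_of_variables_real[OF cf cg der bij]
  have eq: "\<bar>n / m * exp u\<bar> * ?f (n / m * exp u) = h u" for u
  proof -
    have "- pi * m\<^sup>2 * (y * (n / m * exp u)) + - pi * n\<^sup>2 * (y / (n / m * exp u)) = - z * cosh u"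
      using pos by (simp add: z_def cosh_def exp_minus power2_eq_square field_simps)
    hence "exp (- pi * m\<^sup>2 * (y * (n / m * exp u))) * exp (- pi * n\<^sup>2 * (y / (n / m * exp u))) = exp (- z * cosh u)"
      by (simp only: exp_add[symmetric])
    thus ?thesis unfolding h_def using pos by simp
  qed
  have ch: "continuous_on S h" for S unfolding h_def by (intro continuous_intros) auto
  have hint: "set_integrable lborel UNIV h" using cv(1) int unfolding eq by simp
  have hint': "set_integrable lborel S h" if "S \<in> sets borel" for S
    using set_integrable_subset[OF hint] that by auto
  \<comment> \<open>The line is folded at \<open>0\<close>; the factor \<open>1/2\<close> in \<open>h\<close> compensates for the two halves.\<close>
  have neg: "(LBINT u:{..<0}. h u) = (LBINT u:{0<..}. h u)"
  proof -
    have bij': "bij_betw (\<lambda>u. - u) {0<..} {..<0::real}"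
      by (rule bij_betw_byWitness[where f' = uminus]) auto
    have der': "((\<lambda>u. - u) has_field_derivative - 1) (at u within {0<..})" for u :: real
      by (auto intro!: derivative_eq_intros)
    have "(LBINT u:{..<0}. h u) = (LBINT u:{0<..}. \<bar>- 1\<bar> * h (- u))"
      using set_integral_change_of_variables_real(2)[OF ch _ der' bij'] by simp
    thus ?thesis by (simp add: h_def)
  qed
  have "(LBINT \<tau>:{0<..}. ?f \<tau>) = (LBINT u:UNIV. h u)" using cv(2) unfolding eq by simp
  also have "\<dots> = (LBINT u:{..<0} \<union> {0<..}. h u)"
  proof (rule set_integral_cong_set)
    show "set_borel_measurable lborel ({..<0} \<union> {0<..}) h" "set_borel_measurable lborel UNIV h"
      using hint'[of UNIV] hint'[of "{..<0} \<union> {0<..}"] by (auto simp: set_borel_measurable_def set_integrable_def)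
    show "AE u in lborel. (u \<in> {..<0} \<union> {0::real<..}) = (u \<in> UNIV)"
      using AE_lborel_singleton[of "0::real"] by eventually_elim auto
  qed
  also have "\<dots> = (LBINT u:{..<0}. h u) + (LBINT u:{0<..}. h u)"
    by (intro set_integral_Un hint') auto
  also have "\<dots> = (LBINT u:{0<..}. 2 * h u)" by (simp add: neg)
  also have "\<dots> = bessel_K 0 z" by (simp add: bessel_K_def h_def)
  finally show ?thesis by (simp add: z_def)
qed

text \<open>Pairs of positive integers are grouped by their product; the first factor runs through the
  divisors.\<close>

lemma has_sum_divisor_pairs:
  fixes F :: "nat \<Rightarrow> 'a::{comm_monoid_add,topological_space}"
  shows "((\<lambda>p. F (Suc (fst p) * Suc (snd p))) has_sum S) UNIV \<longleftrightarrow>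
         ((\<lambda>(k, d). F (Suc k)) has_sum S) (SIGMA k:UNIV. {d. d dvd Suc k})"
proof -
  define i where "i = (\<lambda>(k, d). (d - 1, Suc k div d - 1))"
  define j where "j = (\<lambda>p. (Suc (fst p) * Suc (snd p) - 1, Suc (fst p)))"
  have Suc: "Suc (Suc m * Suc n - 1) = Suc m * Suc n" for m n by simp
  have ij: "i (j a) = a" for a
  proof -
    have "i (j a) = (Suc (fst a) - 1, Suc (fst a) * Suc (snd a) div Suc (fst a) - 1)"
      by (simp only: i_def j_def prod.case Suc)
    also have "\<dots> = a" by (subst nonzero_mult_div_cancel_left) simp_all
    finally show ?thesis .
  qed
  have jD: "j a \<in> (SIGMA k:UNIV. {d. d dvd Suc k})" for a
    unfolding j_def by (simp only: mem_Sigma_iff mem_Collect_eq Suc) (simp only: dvd_triv_left UNIV_I simp_thms)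
  have ji: "j (i b) = b" if bD: "b \<in> (SIGMA k:UNIV. {d. d dvd Suc k})" for b
  proof -
    obtain k d where b: "b = (k, d)" and "d dvd Suc k" using bD by auto
    then obtain q where q: "Suc k = d * q" by (auto elim: dvdE)
    have "d > 0" "q > 0" using q by (auto intro!: Nat.gr0I)
    moreover from this have "Suc k div d = q" using q by simp
    moreover from calculation have "Suc (d - 1) = d" "Suc (q - 1) = q" by simp_all
    ultimately show ?thesis by (simp only: b i_def j_def prod.case fst_conv snd_conv q[symmetric] diff_Suc_1)
  qed
  show ?thesis
  proof (rule has_sum_reindex_bij_witness[of _ i j])
    show "(case j a of (k, d) \<Rightarrow> F (Suc k)) = F (Suc (fst a) * Suc (snd a))" for a
      by (simp only: j_def prod.case Suc)
  qed (use ij jD ji in auto)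
qed

text \<open>Expanding both theta series gives one Bessel function for each pair \<open>(m, n)\<close>, depending on
  the product \<open>m n\<close> only, so a product \<open>N\<close> is counted once for each divisor.\<close>

lemma theta_conv_sums:
  assumes y: "y > 0"
  shows "(\<lambda>k. 4 * (real (sigma0 (Suc k)) * bessel_K 0 (2 * pi * real (Suc k) * y))) sums theta_conv y"
proof -
  define e where "e = (\<lambda>(m::nat) \<tau>::real. exp (- pi * (real (Suc m))\<^sup>2 * \<tau>))"
  let ?g = "\<lambda>\<tau>. (theta (y * \<tau>) - 1) * (theta (y / \<tau>) - 1) / (2 * \<tau>)"
  define f where "f = (\<lambda>p \<tau>. 4 * (e (fst p) (y * \<tau>) * e (snd p) (y / \<tau>) / (2 * \<tau>)))"
  have e0: "e m \<tau> > 0" for m \<tau> by (simp add: e_def)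
  have e_sum: "((\<lambda>m. 2 * e m \<tau>) has_sum (theta \<tau> - 1)) UNIV" if "\<tau> > 0" for \<tau>
    unfolding e_def by (rule norm_summable_imp_has_sum) (use theta_sums[OF that] in \<open>auto simp: sums_iff\<close>)
  have f0: "f p \<tau> \<ge> 0" if "\<tau> > 0" for p \<tau>
    using that e0 by (simp add: f_def less_imp_le)
  have f_sum: "((\<lambda>p. f p \<tau>) has_sum ?g \<tau>) UNIV" if "\<tau> > 0" for \<tau>
  proof -
    have "((\<lambda>(m, n). 2 * e m (y * \<tau>) * (2 * e n (y / \<tau>))) has_sum (theta (y * \<tau>) - 1) * (theta (y / \<tau>) - 1)) (UNIV \<times> UNIV)"
      by (intro has_sum_product_nonneg e_sum) (use that y e0 in \<open>auto simp: less_imp_le\<close>)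
    from has_sum_divide_const[OF this, of "2 * \<tau>"] show ?thesis
      by (simp add: f_def case_prod_unfold)
  qed
  have f_int: "set_integrable lborel {0<..} (f p)" for p
  proof (rule set_integrable_continuous_dominated[OF theta_conv_integrable[OF y]])
    show "continuous_on {0<..} (f p)" unfolding f_def e_def by (intro continuous_intros) auto
    show "norm (f p \<tau>) \<le> ?g \<tau>" if "\<tau> \<in> {0<..}" for \<tau>
    proof -
      have t: "\<tau> > 0" using that by simp
      have "((\<lambda>p. f p \<tau>) has_sum f p \<tau>) {p}" by (rule has_sum_finiteI) auto
      hence "f p \<tau> \<le> ?g \<tau>"
        by (rule has_sum_mono_neutral[OF _ f_sum[OF t]]) (use f0[OF t] in auto)
      thus ?thesis using f0[OF t, of p] by simp
    qed
  qed auto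
  have "((\<lambda>p. LBINT \<tau>:{0<..}. f p \<tau>) has_sum (LBINT \<tau>:{0<..}. (\<Sum>\<^sub>\<infinity>p. f p \<tau>))) UNIV"
    by (rule has_sum_set_integral[OF f_int _ theta_conv_integrable[OF y]]) (use f_sum f0 in auto)
  also have "(LBINT \<tau>:{0<..}. (\<Sum>\<^sub>\<infinity>p. f p \<tau>)) = theta_conv y"
    unfolding theta_conv_def
    by (intro set_lebesgue_integral_cong) (use infsumI[OF f_sum] in auto)
  also have "(\<lambda>p. LBINT \<tau>:{0<..}. f p \<tau>) =
      (\<lambda>p. 4 * bessel_K 0 (2 * pi * (real (Suc (fst p)) * real (Suc (snd p))) * y))"
  proof
    fix p :: "nat \<times> nat"
    have "set_integrable lborel {0<..} (\<lambda>\<tau>. (1/4) * f p \<tau>)" by (intro set_integrable_mult_right f_int)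
    hence int: "set_integrable lborel {0<..} (\<lambda>\<tau>. e (fst p) (y * \<tau>) * e (snd p) (y / \<tau>) / (2 * \<tau>))"
      by (simp add: f_def)
    have "(LBINT \<tau>:{0<..}. f p \<tau>) = 4 * (LBINT \<tau>:{0<..}. e (fst p) (y * \<tau>) * e (snd p) (y / \<tau>) / (2 * \<tau>))"
      unfolding f_def by (rule set_integral_mult_right)
    also have "\<dots> = 4 * bessel_K 0 (2 * pi * (real (Suc (fst p)) * real (Suc (snd p))) * y)"
      unfolding e_def using bessel_K_0_eq_theta_term[OF _ _ y int[unfolded e_def]] by simp
    finally show "(LBINT \<tau>:{0<..}. f p \<tau>) = \<dots>" .
  qed
  finally have pairs: "((\<lambda>p. 4 * bessel_K 0 (2 * pi * (real (Suc (fst p)) * real (Suc (snd p))) * y)) has_sum theta_conv y) UNIV" .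
  let ?D = "Sigma UNIV (\<lambda>k. {d. d dvd Suc k})"
  have "((\<lambda>(k, d). 4 * bessel_K 0 (2 * pi * real (Suc k) * y)) has_sum theta_conv y) ?D"
    using iffD1[OF has_sum_divisor_pairs[of "\<lambda>N. 4 * bessel_K 0 (2 * pi * real N * y)"]] pairs
    by (simp only: of_nat_mult)
  hence "((\<lambda>k. \<Sum>d | d dvd Suc k. 4 * bessel_K 0 (2 * pi * real (Suc k) * y)) has_sum theta_conv y) UNIV"
    by (rule has_sum_SigmaD) (auto intro!: has_sum_finiteI)
  also have "(\<lambda>k. \<Sum>d | d dvd Suc k. 4 * bessel_K 0 (2 * pi * real (Suc k) * y)) =
      (\<lambda>k. 4 * (real (sigma0 (Suc k)) * bessel_K 0 (2 * pi * real (Suc k) * y)))"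
    by (simp add: sigma0_def fun_eq_iff)
  finally show ?thesis by (rule has_sum_imp_sums)
qed

section \<open>Euler's constant from the pole of the zeta function\<close>

lemma of_real_powr_eq_exp:
  assumes "t > (0::real)"
  shows "complex_of_real t powr z = exp (z * of_real (ln t))"
  using assms by (simp add: powr_def Ln_of_real)

lemma continuous_on_of_real_powr:
  assumes "S \<subseteq> {0<..}"
  shows "continuous_on S (\<lambda>t. complex_of_real t powr z)"
proof -
  have "continuous_on S (\<lambda>t. exp (z * complex_of_real (ln t)))"
    using assms by (intro continuous_intros) auto
  also have "?this \<longleftrightarrow> ?thesis"
    using assms by (intro continuous_on_cong) (auto simp: of_real_powr_eq_exp)
  finally show ?thesis .
qed

lemma gamma_integral_scaled_complex:
  fixes s :: complex and c :: real
  assumes s: "Re s > 0" and c: "c > 0"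
  shows "set_integrable lborel {0<..} (\<lambda>t. complex_of_real (exp (- c * t)) * of_real t powr (s - 1))" (is "set_integrable _ _ ?h")
    and "(LBINT t:{0<..}. complex_of_real (exp (- c * t)) * of_real t powr (s - 1)) = Gamma s * of_real c powr (- s)"
proof -
  define f where "f = (\<lambda>t. complex_of_real t powr (s - 1) / complex_of_real (exp t))"
  have cf: "continuous_on {0<..} f"
    unfolding f_def by (intro continuous_intros continuous_on_of_real_powr) auto
  have fint: "set_integrable lborel {0<..} f" "(LBINT t:{0<..}. f t) = Gamma s"
  proof -
    have a: "f absolutely_integrable_on {0<..}"
      using absolutely_integrable_Gamma_integral'[OF s] by (simp add: f_def)
    show "set_integrable lborel {0<..} f" using a set_integrable_lborel_iff_lebesgue(1)[OF cf] by simp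
    have "(LBINT t:{0<..}. f t) = integral {0<..} f"
      using a set_integrable_lborel_iff_lebesgue(2)[OF cf] by (simp add: set_lebesgue_integral_eq_integral)
    also have "\<dots> = Gamma s" using Gamma_integral_complex'[OF s] by (simp add: f_def integral_unique)
    finally show "(LBINT t:{0<..}. f t) = Gamma s" .
  qed
  have bij: "bij_betw (\<lambda>t. c * t) {0<..} {0<..}"
    by (rule bij_betw_byWitness[where f' = "\<lambda>t. t / c"]) (use c in auto)
  have der: "((\<lambda>t. c * t) has_field_derivative c) (at t within {0<..})" for t
    by (auto intro!: derivative_eq_intros)
  note cv = set_integral_change_of_variables_complex[OF cf continuous_on_const der bij]
  have eq: "\<bar>c\<bar> *\<^sub>R f (c * t) = of_real c powr s * ?h t" if "t \<in> {0<..}" for t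
  proof -
    have t: "t > 0" using that by simp
    have "complex_of_real (c * t) powr (s - 1) = of_real c powr (s - 1) * of_real t powr (s - 1)"
      using c t by (simp add: powr_times_real)
    also have "of_real c * \<dots> = of_real c powr s * complex_of_real t powr (s - 1)"
      using c by (simp add: powr_diff)
    finally show ?thesis
      using c by (simp add: f_def scaleR_conv_of_real exp_minus field_simps)
  qed
  have nz: "complex_of_real c powr s \<noteq> 0" using c by simp
  have "set_integrable lborel {0<..} (\<lambda>t. \<bar>c\<bar> *\<^sub>R f (c * t))" using cv(1) fint(1) by simp
  also have "?this \<longleftrightarrow> set_integrable lborel {0<..} (\<lambda>t. of_real c powr s * ?h t)"
    by (rule set_integrable_cong) (use eq in auto)
  finally show "set_integrable lborel {0<..} ?h" using nz by simp
  have "Gamma s = (LBINT t:{0<..}. \<bar>c\<bar> *\<^sub>R f (c * t))" using cv(2) fint(2) by simp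
  also have "\<dots> = (LBINT t:{0<..}. of_real c powr s * ?h t)"
    by (rule set_lebesgue_integral_cong) (use eq in auto)
  also have "\<dots> = of_real c powr s * (LBINT t:{0<..}. ?h t)" by simp
  finally show "(LBINT t:{0<..}. ?h t) = Gamma s * of_real c powr (- s)"
    using nz by (simp add: powr_minus field_simps)
qed

lemma gamma_integral_scaled_real:
  fixes s c :: real
  assumes s: "s > 0" and c: "c > 0"
  shows "set_integrable lborel {0<..} (\<lambda>t. exp (- c * t) * t powr (s - 1))" (is "set_integrable _ _ ?h")
    and "(LBINT t:{0<..}. exp (- c * t) * t powr (s - 1)) = Gamma s * c powr (- s)"
proof -
  have s': "Re (complex_of_real s) > 0" using s by simp
  note G = gamma_integral_scaled_complex[OF s' c]
  have eq: "complex_of_real (exp (- c * t)) * of_real t powr (of_real s - 1) = of_real (?h t)"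
    if "t \<in> {0<..}" for t
    using that powr_of_real[of t "s - 1"] by simp
  have "set_integrable lborel {0<..} (\<lambda>t. complex_of_real (?h t))"
    using G(1) by (rule iffD1[OF set_integrable_cong, rotated -1]) (use eq in auto)
  thus "set_integrable lborel {0<..} ?h"
    by (subst (asm) set_integrable_complex_iff) simp
  have "complex_of_real (LBINT t:{0<..}. ?h t) = (LBINT t:{0<..}. complex_of_real (?h t))"
    by (rule set_integral_complex_of_real[symmetric])
  also have "\<dots> = (LBINT t:{0<..}. complex_of_real (exp (- c * t)) * of_real t powr (of_real s - 1))"
    by (rule set_lebesgue_integral_cong) (use eq in auto)
  also have "\<dots> = Gamma (of_real s) * of_real c powr (- of_real s)" by (rule G(2))
  also have "\<dots> = of_real (Gamma s * c powr (- s))"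
    using powr_of_real[of c "- s"] c by (simp add: Gamma_complex_of_real)
  finally show "(LBINT t:{0<..}. ?h t) = Gamma s * c powr (- s)"
    by (simp only: of_real_eq_iff)
qed

text \<open>Near \<open>0\<close> the theta function behaves like \<open>t\<^bsup>-1/2\<^esup>\<close>, with a remainder that inversion shows to be
  as small as \<open>\<theta> - 1\<close> is at infinity.\<close>

lemma theta_minus_powr_eq:
  assumes "t > 0"
  shows "theta t - t powr (-1/2) = t powr (-1/2) * (theta (1 / t) - 1)"
proof -
  have "theta t = sqrt (1 / t) * theta (1 / t)" using theta_inversion[of "1 / t"] assms by simp
  also have "sqrt (1 / t) = t powr (-1/2)"
    using assms by (simp add: powr_half_sqrt[symmetric] powr_minus powr_divide inverse_eq_divide)
  finally show ?thesis by (simp add: algebra_simps)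
qed

lemma theta_minus_powr_bounds:
  assumes "t > 0"
  shows "theta t - t powr (-1/2) \<ge> 0" "theta t - t powr (-1/2) \<le> t powr (1/2)"
proof -
  show "theta t - t powr (-1/2) \<ge> 0"
    unfolding theta_minus_powr_eq[OF assms] using theta_ge_1[of "1/t"] assms by simp
  have "theta t - t powr (-1/2) \<le> t powr (-1/2) * t"
    unfolding theta_minus_powr_eq[OF assms]
    using theta_minus_one_le_inverse(1)[of "1 / t"] assms by (intro mult_left_mono) auto
  also have "\<dots> = t powr (-1/2) * t powr 1" using assms by simp
  also have "\<dots> = t powr (1/2)" by (subst powr_add[symmetric]) simp
  finally show "theta t - t powr (-1/2) \<le> t powr (1/2)" .
qed

text \<open>The Mellin transform of \<open>\<theta> - 1\<close>, made convergent at \<open>p = -1/2\<close> by subtracting below the cut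
  \<open>Y\<close> the singular term \<open>t\<^bsup>-1/2\<^esup>\<close> instead of \<open>1\<close>. For \<open>p = s/2 - 1\<close> it differs from
  \<open>2 \<pi>\<^bsup>-s/2\<^esup> \<Gamma>(s/2) \<zeta>(s)\<close> by elementary terms that carry the pole at \<open>s = 1\<close>.\<close>

definition theta_regularized :: "real \<Rightarrow> real \<Rightarrow> real" where
  "theta_regularized Y p = (LBINT t:{Y..}. (theta t - 1) * t powr p) +
     (LBINT t:{0<..Y}. (theta t - t powr (-1/2)) * t powr p)"

lemma powr_le_between:
  assumes "t > (0::real)" "-1/2 \<le> p" "p \<le> 0"
  shows "t powr p \<le> t powr (-1/2) + 1"
proof (cases "t \<le> 1")
  case True
  have "t powr p \<le> t powr (-1/2)" using True assms by (intro powr_mono') auto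
  thus ?thesis by simp
next
  case False
  hence "t powr p \<le> t powr 0" using assms by (intro powr_mono) auto
  thus ?thesis using assms by (simp add: add_increasing)
qed

text \<open>Majorants that do not depend on \<open>p\<close> in \<open>[-1/2, 0]\<close>, for passing to the limit \<open>s \<rightarrow> 1\<close> under the
  integral signs.\<close>

lemma theta_regularized_dominated:
  assumes "Y > 0"
  shows "set_integrable lborel {Y..} (\<lambda>t. t powr (-5/2) + t powr (-2))"
    and "set_integrable lborel {0<..Y} (\<lambda>t. t powr 0 + t powr (1/2))"
    and "\<And>t p. t \<in> {Y..} \<Longrightarrow> -1/2 \<le> p \<Longrightarrow> p \<le> 0 \<Longrightarrow> norm ((theta t - 1) * t powr p) \<le> t powr (-5/2) + t powr (-2)"
    and "\<And>t p. t \<in> {0<..Y} \<Longrightarrow> -1/2 \<le> p \<Longrightarrow> p \<le> 0 \<Longrightarrow> norm ((theta t - t powr (-1/2)) * t powr p) \<le> t powr 0 + t powr (1/2)"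
    and "continuous_on {Y..} (\<lambda>t. (theta t - 1) * t powr p)"
    and "continuous_on {0<..Y} (\<lambda>t. (theta t - t powr (-1/2)) * t powr p)"
proof -
  show "set_integrable lborel {Y..} (\<lambda>t. t powr (-5/2) + t powr (-2))"
    by (intro set_integral_add set_integral_powr_to_inf assms) auto
  show "set_integrable lborel {0<..Y} (\<lambda>t. t powr 0 + t powr (1/2))"
    by (intro set_integral_add set_integral_powr_from_0 assms) auto
  show "norm ((theta t - 1) * t powr p) \<le> t powr (-5/2) + t powr (-2)"
    if "t \<in> {Y..}" "-1/2 \<le> p" "p \<le> 0" for t p
  proof -
    have t: "t > 0" using that assms by auto
    have "norm ((theta t - 1) * t powr p) = (theta t - 1) * t powr p"
      using theta_ge_1[OF t] by simp
    also have "\<dots> \<le> t powr (-2) * (t powr (-1/2) + 1)"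
      using theta_minus_one_le_inverse(2)[OF t] theta_ge_1[OF t] powr_le_between[OF t that(2,3)] t
      by (intro mult_mono) (auto simp: powr_minus powr_numeral inverse_eq_divide)
    also have "\<dots> = t powr (-5/2) + t powr (-2)"
      by (simp add: distrib_left powr_add[symmetric])
    finally show ?thesis .
  qed
  show "norm ((theta t - t powr (-1/2)) * t powr p) \<le> t powr 0 + t powr (1/2)"
    if "t \<in> {0<..Y}" "-1/2 \<le> p" "p \<le> 0" for t p
  proof -
    have t: "t > 0" using that by auto
    have "norm ((theta t - t powr (-1/2)) * t powr p) = (theta t - t powr (-1/2)) * t powr p"
      using theta_minus_powr_bounds(1)[OF t] by (simp add: abs_mult)
    also have "\<dots> \<le> t powr (1/2) * (t powr (-1/2) + 1)"
      using theta_minus_powr_bounds[OF t] powr_le_between[OF t that(2,3)]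
      by (intro mult_mono) auto
    also have "\<dots> = t powr 0 + t powr (1/2)"
      by (simp add: distrib_left powr_add[symmetric])
    finally show ?thesis .
  qed
  show "continuous_on {Y..} (\<lambda>t. (theta t - 1) * t powr p)"
    using assms by (intro continuous_intros) auto
  show "continuous_on {0<..Y} (\<lambda>t. (theta t - t powr (-1/2)) * t powr p)"
    by (intro continuous_intros) auto
qed

lemma theta_regularized_tendsto:
  assumes Y: "Y > 0" and p: "\<And>k. -1/2 \<le> p k" "\<And>k. p k \<le> 0" "p \<longlonglongrightarrow> q"
  shows "(\<lambda>k. theta_regularized Y (p k)) \<longlonglongrightarrow> theta_regularized Y q"
  unfolding theta_regularized_def
proof (intro tendsto_add)
  note D = theta_regularized_dominated[OF Y]
  show "(\<lambda>k. LBINT t:{Y..}. (theta t - 1) * t powr p k) \<longlonglongrightarrow> (LBINT t:{Y..}. (theta t - 1) * t powr q)"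
  proof (rule set_integral_dominated_convergence[OF _ D(1) D(5) D(5) D(3)])
    show "(\<lambda>k. (theta t - 1) * t powr p k) \<longlonglongrightarrow> (theta t - 1) * t powr q" if "t \<in> {Y..}" for t
      using that Y p by (intro tendsto_intros) auto
  qed (use p in auto)
  show "(\<lambda>k. LBINT t:{0<..Y}. (theta t - t powr (-1/2)) * t powr p k) \<longlonglongrightarrow> (LBINT t:{0<..Y}. (theta t - t powr (-1/2)) * t powr q)"
  proof (rule set_integral_dominated_convergence[OF _ D(2) D(6) D(6) D(4)])
    show "(\<lambda>k. (theta t - t powr (-1/2)) * t powr p k) \<longlonglongrightarrow> (theta t - t powr (-1/2)) * t powr q" if "t \<in> {0<..Y}" for t
      using that p by (intro tendsto_intros) auto
  qed (use p in auto)
qed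

lemma theta_mellin_regularized:
  assumes Y: "Y > 0" and s: "1 < s" "s \<le> 2"
  shows "set_integrable lborel {0<..} (\<lambda>t. (theta t - 1) * t powr (s/2 - 1))"
    and "(LBINT t:{0<..}. (theta t - 1) * t powr (s/2 - 1)) =
      theta_regularized Y (s/2 - 1) + 2 * Y powr ((s - 1)/2) / (s - 1) - 2 * Y powr (s/2) / s"
proof -
  define p where "p = s/2 - 1"
  have p: "-1/2 \<le> p" "p \<le> 0" using s by (auto simp: p_def)
  note D = theta_regularized_dominated[OF Y]
  let ?f = "\<lambda>t. (theta t - 1) * t powr p" and ?g = "\<lambda>t. (theta t - t powr (-1/2)) * t powr p"
  have A: "set_integrable lborel {Y..} ?f"
    by (rule set_integrable_continuous_dominated[OF D(1) D(5)]) (use D(3) p in auto)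
  have B: "set_integrable lborel {0<..Y} ?g"
    by (rule set_integrable_continuous_dominated[OF D(2) D(6)]) (use D(4) p in auto)
  have e: "p - 1/2 > -1" "p > -1" using s by (auto simp: p_def)
  note P = set_integral_powr_from_0[OF Y e(1)] set_integral_powr_from_0[OF Y e(2)]
  \<comment> \<open>Replacing \<open>1\<close> by \<open>t\<^bsup>-1/2\<^esup>\<close> below \<open>Y\<close> costs two power integrals, and these produce the two correction terms.\<close>
  have eq: "?f t = ?g t + (t powr (p - 1/2) - t powr p)" for t
    by (simp add: algebra_simps powr_add[symmetric])
  have C: "set_integrable lborel {0<..Y} ?f"
    unfolding eq by (intro set_integral_add(1) set_integral_diff(1) B P)
  have "set_integrable lborel {0<..} ?f" by (rule set_integrable_split_at[OF C A Y])
  note I = this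
  thus "set_integrable lborel {0<..} (\<lambda>t. (theta t - 1) * t powr (s/2 - 1))" by (simp add: p_def)
  have "(LBINT t:{0<..}. ?f t) = (LBINT t:{0<..Y}. ?f t) + (LBINT t:{Y..}. ?f t)"
    by (rule set_integral_split_at[OF I Y])
  also have "(LBINT t:{0<..Y}. ?f t) = (LBINT t:{0<..Y}. ?g t + (t powr (p - 1/2) - t powr p))"
    by (simp only: eq)
  also have "\<dots> = (LBINT t:{0<..Y}. ?g t) + ((LBINT t:{0<..Y}. t powr (p - 1/2)) - (LBINT t:{0<..Y}. t powr p))"
    by (subst set_integral_add(2)[OF B set_integral_diff(1)[OF P(1) P(3)]]) (simp add: set_integral_diff(2)[OF P(1) P(3)])
  also have "(LBINT t:{0<..Y}. t powr (p - 1/2)) = 2 * Y powr ((s - 1)/2) / (s - 1)"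
  proof -
    have e': "p - 1/2 + 1 = (s - 1)/2" by (simp add: p_def field_simps)
    show ?thesis unfolding P(2) e' by simp
  qed
  also have "(LBINT t:{0<..Y}. t powr p) = 2 * Y powr (s/2) / s"
    unfolding P(4) by (simp add: p_def)
  finally show "(LBINT t:{0<..}. (theta t - 1) * t powr (s/2 - 1)) =
      theta_regularized Y (s/2 - 1) + 2 * Y powr ((s - 1)/2) / (s - 1) - 2 * Y powr (s/2) / s"
    unfolding theta_regularized_def p_def by simp
qed

lemma theta_mellin_sums:
  assumes s: "1 < s" "s \<le> 2"
  shows "(\<lambda>n. 2 * pi powr (- s/2) * Gamma (s/2) * real (Suc n) powr (- s)) sums
    (LBINT t:{0<..}. (theta t - 1) * t powr (s/2 - 1))"
proof -
  define f where "f = (\<lambda>n t. 2 * (exp (- (pi * (real (Suc n))\<^sup>2) * t) * t powr (s/2 - 1)))"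
  have s2: "s / 2 > 0" using s by simp
  note G = gamma_integral_scaled_real[OF s2]
  have fs: "(\<lambda>n. f n t) sums ((theta t - 1) * t powr (s/2 - 1))" if "t > 0" for t
    using sums_mult2[OF theta_sums[OF that], of "t powr (s/2 - 1)"] by (simp add: f_def mult_ac)
  have fn: "f n t \<ge> 0" for n t by (simp add: f_def)
  have fh: "((\<lambda>n. f n t) has_sum ((theta t - 1) * t powr (s/2 - 1))) UNIV" if "t > 0" for t
    using fs[OF that] fn by (intro norm_summable_imp_has_sum) (auto simp: sums_iff)
  have "((\<lambda>n. LBINT t:{0<..}. f n t) has_sum (LBINT t:{0<..}. (\<Sum>\<^sub>\<infinity>n. f n t))) UNIV"
  proof (rule has_sum_set_integral[OF _ _ theta_mellin_regularized(1)[OF zero_less_one s]])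
    show "set_integrable lborel {0<..} (f n)" for n
      unfolding f_def by (intro set_integrable_mult_right G) auto
    show "((\<lambda>n. norm (f n t)) has_sum ((theta t - 1) * t powr (s/2 - 1))) UNIV" if "t \<in> {0<..}" for t
      using fh[of t] that fn by simp
  qed
  also have "(LBINT t:{0<..}. (\<Sum>\<^sub>\<infinity>n. f n t)) = (LBINT t:{0<..}. (theta t - 1) * t powr (s/2 - 1))"
    by (intro set_lebesgue_integral_cong) (auto intro!: infsumI fh)
  also have "(\<lambda>n. LBINT t:{0<..}. f n t) = (\<lambda>n. 2 * pi powr (- s/2) * Gamma (s/2) * real (Suc n) powr (- s))"
  proof
    fix n :: nat
    have "(LBINT t:{0<..}. f n t) = 2 * (Gamma (s/2) * (pi * (real (Suc n))\<^sup>2) powr (- (s/2)))"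
      unfolding f_def by (subst set_integral_mult_right, subst G(2)) auto
    also have "(pi * (real (Suc n))\<^sup>2) powr (- (s/2)) = pi powr (- (s/2)) * ((real (Suc n)) powr 2) powr (- (s/2))"
      by (simp add: powr_mult powr_numeral)
    also have "((real (Suc n)) powr 2) powr (- (s/2)) = real (Suc n) powr (- s)"
      by (simp only: powr_powr) simp
    finally show "(LBINT t:{0<..}. f n t) = 2 * pi powr (- s/2) * Gamma (s/2) * real (Suc n) powr (- s)"
      by simp
  qed
  finally show ?thesis by (rule has_sum_imp_sums)
qed

text \<open>The fraction is the integral of \<open>u\<^bsup>-s\<^esup>\<close> over \<open>[n+1, n+2]\<close>. By the mean value theorem it is
  a value \<open>z\<^bsup>-s\<^esup>\<close> inside this interval, and a second use of the theorem bounds the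
  difference uniformly in \<open>s\<close>.\<close>

lemma zeta_term_bounds:
  fixes s :: real
  assumes s: "1 < s" "s \<le> 2"
  defines "d \<equiv> \<lambda>n. real (Suc n) powr (- s) - (real (Suc n) powr (1 - s) - real (Suc (Suc n)) powr (1 - s)) / (s - 1)"
  shows "norm (d n) \<le> 2 / (real (Suc n))\<^sup>2"
proof -
  let ?a = "real (Suc n)" and ?b = "real (Suc (Suc n))"
  have "\<exists>z. ?a < z \<and> z < ?b \<and> ?b powr (1 - s) / (1 - s) - ?a powr (1 - s) / (1 - s) = (?b - ?a) * z powr (- s)"
  proof (rule MVT2)
    fix x assume "?a \<le> x" "x \<le> ?b"
    thus "((\<lambda>x. x powr (1 - s) / (1 - s)) has_real_derivative x powr (- s)) (at x)"
      using s by (auto intro!: derivative_eq_intros)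
  qed simp
  then obtain z where z: "?a < z" "z < ?b" "?b powr (1 - s) / (1 - s) - ?a powr (1 - s) / (1 - s) = z powr (- s)"
    by auto
  have "(?a powr (1 - s) - ?b powr (1 - s)) / (s - 1) = ?b powr (1 - s) / (1 - s) - ?a powr (1 - s) / (1 - s)"
    using s by (simp add: divide_simps) (simp add: algebra_simps)
  hence d: "d n = ?a powr (- s) - z powr (- s)" unfolding d_def z(3) by simp
  have "\<exists>w. ?a < w \<and> w < z \<and> z powr (- s) - ?a powr (- s) = (z - ?a) * (- s * w powr (- s - 1))"
  proof (rule MVT2)
    fix x assume "?a \<le> x" "x \<le> z"
    thus "((\<lambda>x. x powr (- s)) has_real_derivative - s * x powr (- s - 1)) (at x)"
      by (auto intro!: derivative_eq_intros)
  qed (use z in simp)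
  then obtain w where w: "?a < w" "w < z" "z powr (- s) - ?a powr (- s) = (z - ?a) * (- s * w powr (- s - 1))"
    by auto
  have "d n = (z - ?a) * (s * w powr (- s - 1))" using w(3) by (simp add: d)
  hence "norm (d n) = (z - ?a) * (s * w powr (- s - 1))" using z s by (simp add: abs_mult)
  also have "\<dots> \<le> 1 * (2 * ?a powr (-2))"
  proof (intro mult_mono)
    have "w powr (- s - 1) \<le> w powr (-2)" using w s by (intro powr_mono) auto
    also have "\<dots> \<le> ?a powr (-2)" using w by (intro powr_mono2') auto
    finally show "w powr (- s - 1) \<le> ?a powr (-2)" .
  qed (use z s in auto)
  also have "\<dots> = 2 / ?a\<^sup>2" by (simp add: powr_minus powr_numeral inverse_eq_divide)
  finally show ?thesis .
qed

text \<open>The subtracted terms telescope to \<open>1 / (s - 1)\<close>, the integral of \<open>u\<^bsup>-s\<^esup>\<close> over \<open>[1, \<infinity>)\<close>.\<close>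

lemma zeta_minus_pole_sums:
  fixes s Z :: real
  assumes s: "1 < s" "s \<le> 2" and Z: "(\<lambda>n. real (Suc n) powr (- s)) sums Z"
  shows "(\<lambda>n. real (Suc n) powr (- s) - (real (Suc n) powr (1 - s) - real (Suc (Suc n)) powr (1 - s)) / (s - 1)) sums (Z - 1 / (s - 1))"
proof -
  have "(\<lambda>n. real (Suc n) powr (1 - s)) \<longlonglongrightarrow> 0"
    using s filterlim_compose[OF filterlim_real_sequentially filterlim_Suc]
    by (intro tendsto_neg_powr) simp_all
  from sums_divide[OF telescope_sums'[OF this], of "s - 1"]
  have "(\<lambda>n. (real (Suc n) powr (1 - s) - real (Suc (Suc n)) powr (1 - s)) / (s - 1)) sums (1 / (s - 1))"
    by simp
  from sums_diff[OF Z this] show ?thesis .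
qed

lemma zeta_term_tendsto:
  fixes \<sigma> :: "nat \<Rightarrow> real" and a b :: real
  assumes "\<sigma> \<longlonglongrightarrow> 1" "\<And>k. \<sigma> k > 1" "a > 0" "b > 0"
  shows "(\<lambda>k. a powr (- \<sigma> k) - (a powr (1 - \<sigma> k) - b powr (1 - \<sigma> k)) / (\<sigma> k - 1)) \<longlonglongrightarrow> 1 / a + ln a - ln b"
proof -
  have "((\<lambda>s. a powr (1 - s) - b powr (1 - s)) has_real_derivative (ln b - ln a)) (at 1)"
    using assms by (auto intro!: derivative_eq_intros)
  hence "((\<lambda>s. (a powr (1 - s) - b powr (1 - s)) / (s - 1)) \<longlongrightarrow> ln b - ln a) (at 1)"
    using assms by (simp add: has_field_derivative_iff)
  moreover have "filterlim \<sigma> (at 1) sequentially"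
    using assms(1,2) by (auto simp: filterlim_at intro!: always_eventually) (metis less_irrefl)
  ultimately have "(\<lambda>k. (a powr (1 - \<sigma> k) - b powr (1 - \<sigma> k)) / (\<sigma> k - 1)) \<longlonglongrightarrow> ln b - ln a"
    by (rule filterlim_compose)
  moreover have "(\<lambda>k. a powr (- \<sigma> k)) \<longlonglongrightarrow> a powr (- 1)"
    using assms by (intro tendsto_intros) auto
  ultimately have "(\<lambda>k. a powr (- \<sigma> k) - (a powr (1 - \<sigma> k) - b powr (1 - \<sigma> k)) / (\<sigma> k - 1)) \<longlonglongrightarrow> a powr (- 1) - (ln b - ln a)"
    by (intro tendsto_diff)
  also have "a powr (- 1) - (ln b - ln a) = 1 / a + ln a - ln b"
    using assms by (simp add: powr_minus inverse_eq_divide)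
  finally show ?thesis .
qed

text \<open>The constant term of the zeta function at its pole is Euler's constant: by Tannery's theorem the
  limit may be taken in each term, which yields a series for \<open>\<gamma>\<close>.\<close>

lemma zeta_minus_pole_tendsto:
  fixes \<sigma> Z :: "nat \<Rightarrow> real"
  assumes \<sigma>: "\<sigma> \<longlonglongrightarrow> 1" "\<And>k. 1 < \<sigma> k" "\<And>k. \<sigma> k \<le> 2"
    and Z: "\<And>k. (\<lambda>n. real (Suc n) powr (- \<sigma> k)) sums Z k"
  shows "(\<lambda>k. Z k - 1 / (\<sigma> k - 1)) \<longlonglongrightarrow> euler_mascheroni"
proof -
  let ?d = "\<lambda>n k. real (Suc n) powr (- \<sigma> k) - (real (Suc n) powr (1 - \<sigma> k) - real (Suc (Suc n)) powr (1 - \<sigma> k)) / (\<sigma> k - 1)"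
  let ?b = "\<lambda>n. inverse (real (n + 1)) + ln (real (n + 1)) - ln (real (n + 2))"
  have M: "summable (\<lambda>n. 2 / (real (Suc n))\<^sup>2)"
    using summable_mult[OF summable_Suc_iff[THEN iffD2, OF inverse_power_summable[of 2, where ?'a = real]], of 2]
    by (simp add: inverse_eq_divide power_divide)
  have "((\<lambda>k. \<Sum>n. ?d n k) \<longlongrightarrow> (\<Sum>n. ?b n)) sequentially"
  proof (rule tannerys_theorem[THEN conjunct2, THEN conjunct2])
    show "(\<lambda>k. ?d n k) \<longlonglongrightarrow> ?b n" for n
      using zeta_term_tendsto[OF \<sigma>(1,2), of "real (Suc n)" "real (Suc (Suc n))"]
      by (simp add: inverse_eq_divide add.commute)
    show "summable (\<lambda>n. 2 / (real (Suc n))\<^sup>2)" by (rule M)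
    show "\<forall>\<^sub>F (n, k) in at_top \<times>\<^sub>F sequentially. norm (?d n k) \<le> 2 / (real (Suc n))\<^sup>2"
      using zeta_term_bounds[OF \<sigma>(2,3)] by (intro always_eventually) auto
  qed simp
  also have "(\<lambda>k. \<Sum>n. ?d n k) = (\<lambda>k. Z k - 1 / (\<sigma> k - 1))"
    using sums_unique[OF zeta_minus_pole_sums[OF \<sigma>(2,3) Z]] by (simp add: fun_eq_iff)
  also have "(\<Sum>n. ?b n) = euler_mascheroni"
    using sums_unique[OF euler_mascheroni_sum_real] by simp
  finally show ?thesis .
qed

text \<open>Writing \<open>h(s) = 2 \<pi>\<^bsup>-s/2\<^esup> \<Gamma>(s/2)\<close>, the quantity is
  \<open>h(s) (\<zeta>(s) - 1/(s-1)) + (h(s) - 2 Y\<^bsup>(s-1)/2\<^esup>)/(s-1) + 2 Y\<^bsup>s/2\<^esup>/s\<close> for \<open>s > 1\<close>. As \<open>s \<rightarrow> 1\<close> the first summand tends to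
  \<open>2 \<gamma>\<close> and the second to a derivative at \<open>1\<close>, where \<open>\<psi>(1/2) = -\<gamma> - 2 log 2\<close> enters.\<close>

lemma theta_regularized_at_half:
  assumes Y: "Y > 0"
  shows "theta_regularized Y (-1/2) = euler_mascheroni - ln (4 * pi) - ln Y + 2 * sqrt Y"
proof -
  \<comment> \<open>Any sequence in \<open>(1, 2]\<close> with limit \<open>1\<close> serves; dominated convergence is about sequences.\<close>
  define \<sigma> :: "nat \<Rightarrow> real" where "\<sigma> = (\<lambda>k. 1 + 1 / real (Suc k))"
  have \<sigma>: "1 < \<sigma> k" "\<sigma> k \<le> 2" for k by (auto simp: \<sigma>_def)
  have \<sigma>_lim: "\<sigma> \<longlonglongrightarrow> 1"
    unfolding \<sigma>_def using tendsto_add[OF tendsto_const LIMSEQ_inverse_real_of_nat, of 1]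
    by (simp add: inverse_eq_divide)
  have \<sigma>_at: "filterlim \<sigma> (at 1) sequentially"
    using \<sigma>_lim \<sigma>(1) by (auto simp: filterlim_at intro!: always_eventually) (metis less_irrefl)
  define h where "h = (\<lambda>s::real. 2 * pi powr (- s/2) * Gamma (s/2))"
  define I where "I = (\<lambda>k. LBINT t:{0<..}. (theta t - 1) * t powr (\<sigma> k/2 - 1))"
  define Z where "Z = (\<lambda>k. I k / h (\<sigma> k))"
  have h_pos: "h s > 0" if "s > 0" for s
    using that Gamma_real_pos[of "s/2"] by (simp add: h_def)
  have hZ: "I k = h (\<sigma> k) * Z k" for k using h_pos[of "\<sigma> k"] \<sigma>(1)[of k] by (simp add: Z_def)
  have Zs: "(\<lambda>n. real (Suc n) powr (- \<sigma> k)) sums Z k" for k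
  proof -
    have "\<sigma> k / 2 > 0" using \<sigma>(1)[of k] by simp
    hence "Gamma (\<sigma> k / 2) \<noteq> 0" using Gamma_real_pos[of "\<sigma> k / 2"] by linarith
    thus ?thesis
      using sums_divide[OF theta_mellin_sums[OF \<sigma>, of k], of "h (\<sigma> k)"]
      by (simp add: Z_def I_def h_def)
  qed
  have D_lim: "(\<lambda>k. Z k - 1 / (\<sigma> k - 1)) \<longlonglongrightarrow> euler_mascheroni"
    by (rule zeta_minus_pole_tendsto[OF \<sigma>_lim \<sigma> Zs])
  have h1: "h 1 = 2" by (simp add: h_def Gamma_one_half_real powr_minus powr_half_sqrt)
  have h_der: "(h has_real_derivative (- ln pi - euler_mascheroni - 2 * ln 2)) (at 1)"
  proof -
    have n: "(1/2::real) \<notin> \<int>\<^sub>\<le>\<^sub>0" by (auto elim!: nonpos_Ints_cases simp: field_simps)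
    have "(h has_real_derivative (2 * (pi powr (-1/2) * (- 1/2 * ln pi)) * Gamma (1/2) +
        2 * pi powr (-1/2) * (Gamma (1/2) * Digamma (1/2) * (1/2)))) (at 1)"
      unfolding h_def using n by (auto intro!: derivative_eq_intros)
    also have "2 * (pi powr (-1/2) * (- 1/2 * ln pi)) * Gamma (1/2) +
        2 * pi powr (-1/2) * (Gamma (1/2) * Digamma (1/2) * (1/2)) =
        (pi powr (-1/2) * Gamma (1/2)) * (- ln pi + Digamma (1/2))"
      by (simp add: algebra_simps)
    also have "pi powr (-1/2) * Gamma (1/2) = 1" using h1 by (simp add: h_def)
    also have "1 * (- ln pi + Digamma (1/2)) = - ln pi - euler_mascheroni - 2 * ln 2"
      using Digamma_one_half[where 'a = real] by simp
    finally show ?thesis .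
  qed
  have Y_der: "((\<lambda>s. 2 * Y powr ((s - 1)/2)) has_real_derivative ln Y) (at 1)"
    using Y by (auto intro!: derivative_eq_intros)
  have "((\<lambda>s. h s - 2 * Y powr ((s - 1)/2)) has_real_derivative (- ln pi - euler_mascheroni - 2 * ln 2 - ln Y)) (at 1)"
    by (intro DERIV_diff h_der Y_der)
  hence "((\<lambda>s. (h s - 2 * Y powr ((s - 1)/2)) / (s - 1)) \<longlongrightarrow> (- ln pi - euler_mascheroni - 2 * ln 2 - ln Y)) (at 1)"
    using Y by (simp add: has_field_derivative_iff h1)
  from filterlim_compose[OF this \<sigma>_at]
  have Q_lim: "(\<lambda>k. (h (\<sigma> k) - 2 * Y powr ((\<sigma> k - 1)/2)) / (\<sigma> k - 1)) \<longlonglongrightarrow> - ln pi - euler_mascheroni - 2 * ln 2 - ln Y" .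
  have h_lim: "(\<lambda>k. h (\<sigma> k)) \<longlonglongrightarrow> 2"
    using isCont_tendsto_compose[OF DERIV_isCont[OF h_der] \<sigma>_lim] by (simp add: h1)
  have R_lim: "(\<lambda>k. 2 * Y powr (\<sigma> k/2) / \<sigma> k) \<longlonglongrightarrow> 2 * Y powr (1/2) / 1"
    using Y by (intro tendsto_intros \<sigma>_lim) auto
  have "(\<lambda>k. h (\<sigma> k) * (Z k - 1 / (\<sigma> k - 1)) + (h (\<sigma> k) - 2 * Y powr ((\<sigma> k - 1)/2)) / (\<sigma> k - 1) + 2 * Y powr (\<sigma> k/2) / \<sigma> k)
      \<longlonglongrightarrow> 2 * euler_mascheroni + (- ln pi - euler_mascheroni - 2 * ln 2 - ln Y) + 2 * Y powr (1/2) / 1"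
    by (intro tendsto_add tendsto_mult h_lim D_lim Q_lim R_lim)
  moreover have "h (\<sigma> k) * (Z k - 1 / (\<sigma> k - 1)) + (h (\<sigma> k) - 2 * Y powr ((\<sigma> k - 1)/2)) / (\<sigma> k - 1) + 2 * Y powr (\<sigma> k/2) / \<sigma> k =
      theta_regularized Y (\<sigma> k/2 - 1)" for k
  proof -
    have "theta_regularized Y (\<sigma> k/2 - 1) = h (\<sigma> k) * Z k - 2 * Y powr ((\<sigma> k - 1)/2) / (\<sigma> k - 1) + 2 * Y powr (\<sigma> k/2) / \<sigma> k"
      using theta_mellin_regularized(2)[OF Y \<sigma>, of k] hZ[of k] by (simp add: I_def)
    thus ?thesis by (simp add: right_diff_distrib diff_divide_distrib)
  qed
  ultimately have "(\<lambda>k. theta_regularized Y (\<sigma> k/2 - 1)) \<longlonglongrightarrow> 2 * euler_mascheroni + (- ln pi - euler_mascheroni - 2 * ln 2 - ln Y) + 2 * Y powr (1/2) / 1"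
    by simp
  moreover have "(\<lambda>k. theta_regularized Y (\<sigma> k/2 - 1)) \<longlonglongrightarrow> theta_regularized Y (1/2 - 1)"
  proof (intro theta_regularized_tendsto[OF Y] tendsto_intros \<sigma>_lim)
    show "-1/2 \<le> \<sigma> k/2 - 1" "\<sigma> k/2 - 1 \<le> 0" for k using \<sigma>[of k] by simp_all
  qed simp
  ultimately have "theta_regularized Y (1/2 - 1) = 2 * euler_mascheroni + (- ln pi - euler_mascheroni - 2 * ln 2 - ln Y) + 2 * Y powr (1/2) / 1"
    by (rule LIMSEQ_unique[rotated])
  moreover have "ln (4 * pi) = 2 * ln 2 + ln pi"
    using ln_realpow[of 2 2] by (simp add: ln_mult)
  ultimately show ?thesis using Y by (simp add: powr_half_sqrt)
qed

section \<open>Continuation of the Eisenstein series\<close>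

lemma norm_of_real_powr:
  "t > 0 \<Longrightarrow> norm (complex_of_real t powr z) = t powr Re z"
  by (subst norm_powr_real_powr) auto

lemma rapid_decay_mellin_integrable:
  fixes \<phi> :: "real \<Rightarrow> real"
  assumes cont: "continuous_on {1..} \<phi>"
    and bound: "\<And>t. t \<ge> 1 \<Longrightarrow> \<bar>\<phi> t\<bar> \<le> C * t powr (- r - 2)" and z: "Re z \<le> r"
  shows "set_integrable lborel {1..} (\<lambda>t. of_real (\<phi> t) * complex_of_real t powr z)"
    and "c \<ge> 1 \<Longrightarrow> norm (LBINT t:{c..}. of_real (\<phi> t) * complex_of_real t powr z) \<le> C / c"
proof -
  let ?f = "\<lambda>t. of_real (\<phi> t) * complex_of_real t powr z"
  have P: "set_integrable lborel {c..} (\<lambda>t. C * t powr (-2))" "(LBINT t:{c..}. C * t powr (-2)) = C / c"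
    if "c \<ge> 1" for c
  proof -
    show "set_integrable lborel {c..} (\<lambda>t. C * t powr (-2))"
      by (intro set_integrable_mult_right set_integral_powr_to_inf(1)) (use that in auto)
    show "(LBINT t:{c..}. C * t powr (-2)) = C / c"
      using that by (subst set_integral_mult_right, subst set_integral_powr_to_inf(2))
        (simp_all add: powr_minus inverse_eq_divide)
  qed
  have le: "norm (?f t) \<le> C * t powr (-2)" if "t \<ge> 1" for t
  proof -
    have "norm (?f t) = \<bar>\<phi> t\<bar> * t powr Re z"
      using that by (simp add: norm_mult norm_of_real_powr)
    also have "\<dots> \<le> (C * t powr (- r - 2)) * t powr r"
      using bound[OF that] z that by (intro mult_mono powr_mono) auto
    also have "\<dots> = C * t powr (-2)" by (simp add: powr_add[symmetric])
    finally show ?thesis .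
  qed
  have cf: "continuous_on {1..} ?f"
    by (intro continuous_intros cont continuous_on_of_real_powr) auto
  show I: "set_integrable lborel {1..} ?f"
    by (rule set_integrable_continuous_dominated[OF P(1)[of 1] cf]) (use le in auto)
  assume c: "c \<ge> 1"
  have Ic: "set_integrable lborel {c..} ?f" by (rule set_integrable_subset[OF I]) (use c in auto)
  have "norm (LBINT t:{c..}. ?f t) \<le> (LBINT t:{c..}. norm (?f t))"
    by (rule set_integral_norm_bound[OF Ic])
  also have "\<dots> \<le> (LBINT t:{c..}. C * t powr (-2))"
    by (intro set_integral_mono P c set_integrable_norm Ic) (use le c in auto)
  also have "\<dots> = C / c" by (rule P(2)[OF c])
  finally show "norm (LBINT t:{c..}. ?f t) \<le> C / c" .
qed

text \<open>Over a compact interval differentiation under the integral sign applies; the truncations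
  converge locally uniformly by the tail estimate.\<close>

lemma rapid_decay_mellin_holomorphic:
  fixes \<phi> :: "real \<Rightarrow> real"
  assumes cont: "continuous_on {1..} \<phi>"
    and bound: "\<And>r. \<exists>C. \<forall>t\<ge>1. \<bar>\<phi> t\<bar> \<le> C * t powr (- r - 2)"
  shows "(\<lambda>z. LBINT t:{1..}. of_real (\<phi> t) * complex_of_real t powr z) holomorphic_on UNIV"
proof -
  let ?f = "\<lambda>z t. of_real (\<phi> t) * complex_of_real t powr z"
  let ?F = "\<lambda>z. LBINT t:{1..}. ?f z t"
  let ?Fn = "\<lambda>n z. integral (cbox 1 (real (Suc n))) (\<lambda>t. of_real (\<phi> t) * exp (z * complex_of_real (ln t)))"
  have int: "set_integrable lborel {1..} (?f z)" for z
  proof -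
    obtain C where "\<forall>t\<ge>1. \<bar>\<phi> t\<bar> \<le> C * t powr (- Re z - 2)" using bound by blast
    thus ?thesis by (intro rapid_decay_mellin_integrable(1)[OF cont, of C "Re z"]) auto
  qed
  have split: "?F z = ?Fn n z + (LBINT t:{real (Suc n)..}. ?f z t)" for n z
  proof -
    have "{1..} = {1..real (Suc n)} \<union> {real (Suc n)..}" by auto
    moreover have "(LBINT t:{1..real (Suc n)} \<union> {real (Suc n)..}. ?f z t) =
        (LBINT t:{1..real (Suc n)}. ?f z t) + (LBINT t:{real (Suc n)..}. ?f z t)"
    proof (rule set_integral_Un_AE)
      show "AE t in lborel. \<not> (t \<in> {1..real (Suc n)} \<and> t \<in> {real (Suc n)..})"
        using AE_lborel_singleton[of "real (Suc n)"] by eventually_elim auto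
      show "set_integrable lborel {1..real (Suc n)} (?f z)" "set_integrable lborel {real (Suc n)..} (?f z)"
        by (rule set_integrable_subset[OF int]; auto)+
    qed auto
    moreover have "(LBINT t:{1..real (Suc n)}. ?f z t) = integral {1..real (Suc n)} (?f z)"
      by (intro set_borel_integral_eq_integral(2) set_integrable_subset[OF int]) auto
    moreover have "integral {1..real (Suc n)} (?f z) = ?Fn n z"
      by (simp only: box_real) (intro integral_cong, simp add: of_real_powr_eq_exp)
    ultimately show ?thesis by simp
  qed
  have "?F holomorphic_on UNIV"
  proof (rule holomorphic_uniform_sequence[where f = ?Fn])
    show "?Fn n holomorphic_on UNIV" for n
    proof (rule leibniz_rule_holomorphic)
      let ?d = "\<lambda>z t. of_real (\<phi> t) * (exp (z * complex_of_real (ln t)) * complex_of_real (ln t))"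
      show "((\<lambda>z. of_real (\<phi> t) * exp (z * complex_of_real (ln t))) has_field_derivative ?d z t) (at z within UNIV)" for z t
        by (auto intro!: derivative_eq_intros)
      show "(\<lambda>t. of_real (\<phi> t) * exp (z * complex_of_real (ln t))) integrable_on cbox 1 (real (Suc n))" for z
        by (intro integrable_continuous continuous_intros continuous_on_subset[OF cont]) auto
      show "continuous_on (UNIV \<times> cbox 1 (real (Suc n))) (\<lambda>(z, t). ?d z t)"
        unfolding split_beta
        by (intro continuous_intros continuous_on_compose2[OF cont]) auto
    qed auto
    show "\<exists>d>0. cball z d \<subseteq> UNIV \<and> uniform_limit (cball z d) ?Fn ?F sequentially" for z
    proof (intro exI[of _ 1] conjI)
      \<comment> \<open>On the disc of radius \<open>1\<close> around \<open>z\<close> all real parts are at most \<open>r\<close>, so one constant \<open>C\<close> serves.\<close>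
      define r where "r = norm z + 1"
      obtain C where C: "\<And>t. t \<ge> 1 \<Longrightarrow> \<bar>\<phi> t\<bar> \<le> C * t powr (- r - 2)" using bound by blast
      show "uniform_limit (cball z 1) ?Fn ?F sequentially"
      proof (rule uniform_limitI)
        fix e :: real assume e: "e > 0"
        have "(\<lambda>n. C * inverse (real (Suc n))) \<longlonglongrightarrow> C * 0"
          by (intro tendsto_intros LIMSEQ_inverse_real_of_nat)
        hence "\<forall>\<^sub>F n in sequentially. C * inverse (real (Suc n)) < e"
          using e by (intro order_tendstoD) auto
        thus "\<forall>\<^sub>F n in sequentially. \<forall>w\<in>cball z 1. dist (?Fn n w) (?F w) < e"
        proof eventually_elim
          case (elim n)
          show ?case
          proof
            fix w assume "w \<in> cball z 1"
            hence "norm (w - z) \<le> 1" by (simp add: dist_norm norm_minus_commute)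
            hence "norm w \<le> r" using norm_triangle_sub[of w z] by (simp add: r_def)
            hence "Re w \<le> r" using complex_Re_le_cmod[of w] by linarith
            from rapid_decay_mellin_integrable(2)[OF cont C this, of "real (Suc n)"]
            have "dist (?Fn n w) (?F w) \<le> C / real (Suc n)"
              by (simp add: dist_norm split[of w n] norm_minus_commute)
            thus "dist (?Fn n w) (?F w) < e" using elim by (simp add: inverse_eq_divide)
          qed
        qed
      qed
    qed auto
  qed auto
  thus ?thesis .
qed

text \<open>The theta series of the quadratic form \<open>|m i y + n|\<^sup>2 / y = m\<^sup>2 y + n\<^sup>2 / y\<close>.\<close>

definition theta2 :: "real \<Rightarrow> real \<Rightarrow> real" where
  "theta2 y t = theta (y * t) * theta (t / y)"

lemma theta2_inversion:
  assumes "y > 0" "t > 0"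
  shows "theta2 y (1 / t) = t * theta2 y t"
proof -
  have "theta (y * (1 / t)) = sqrt (t / y) * theta (t / y)"
    using theta_inversion[of "t / y"] assms by simp
  moreover have "theta (1 / t / y) = sqrt (y * t) * theta (y * t)"
    using theta_inversion[of "y * t"] assms by (simp add: mult.commute)
  moreover have "sqrt (t / y) * sqrt (y * t) = t"
    using assms by (simp add: real_sqrt_mult[symmetric])
  ultimately show ?thesis unfolding theta2_def
    by (metis (no_types, lifting) mult.assoc mult.commute mult.left_commute)
qed

lemma theta2_ge_1: "y > 0 \<Longrightarrow> t > 0 \<Longrightarrow> theta2 y t \<ge> 1"
  unfolding theta2_def
  using mult_mono[of 1 "theta (y * t)" 1 "theta (t / y)"] theta_ge_1[of "y * t"] theta_ge_1[of "t / y"] by simp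

lemma continuous_on_theta2: "y > 0 \<Longrightarrow> S \<subseteq> {0<..} \<Longrightarrow> continuous_on S (theta2 y)"
  unfolding theta2_def[abs_def] by (intro continuous_intros) auto

lemma theta_rapid_decay:
  assumes c: "c > 0"
  shows "\<exists>C\<ge>0. \<forall>t\<ge>1. theta (c * t) - 1 \<le> C * t powr (- r)"
proof -
  \<comment> \<open>The exponent is rounded up, and is at least \<open>1\<close> because the bound on \<open>\<theta> - 1\<close> has no case \<open>j = 0\<close>.\<close>
  define j where "j = nat \<lceil>max r 1\<rceil>"
  have j: "j \<ge> 1" "real j \<ge> r" unfolding j_def by linarith+
  define C where "C = 2 * fact j / (pi * c) ^ j"
  have C: "C \<ge> 0" using c by (simp add: C_def)
  have "theta (c * t) - 1 \<le> C * t powr (- r)" if t: "t \<ge> 1" for t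
  proof -
    have "theta (c * t) - 1 \<le> 2 * fact j / (pi * (c * t)) ^ j"
      using c t j by (intro theta_minus_one_le) auto
    also have "\<dots> = C * t powr (- real j)"
      using t by (simp add: C_def power_mult_distrib powr_minus powr_realpow divide_inverse)
    also have "\<dots> \<le> C * t powr (- r)"
      using t j C by (intro mult_left_mono powr_mono) auto
    finally show ?thesis .
  qed
  thus ?thesis using C by blast
qed

lemma theta2_rapid_decay:
  assumes y: "y > 0"
  shows "\<exists>C. \<forall>t\<ge>1. \<bar>theta2 y t - 1\<bar> \<le> C * t powr (- r - 2)"
proof -
  \<comment> \<open>\<open>q \<ge> 0\<close> keeps the single bounds bounded on \<open>[1, \<infinity>)\<close>, so that the product \<open>a b\<close> obeys the same bound.\<close>
  define q where "q = max 0 (r + 2)"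
  obtain A where A: "A \<ge> 0" "\<And>t. t \<ge> 1 \<Longrightarrow> theta (y * t) - 1 \<le> A * t powr (- q)"
    using theta_rapid_decay[OF y] by blast
  obtain B where B: "B \<ge> 0" "\<And>t. t \<ge> 1 \<Longrightarrow> theta (1 / y * t) - 1 \<le> B * t powr (- q)"
    using theta_rapid_decay[of "1 / y"] y by auto
  have "\<bar>theta2 y t - 1\<bar> \<le> (A * B + A + B) * t powr (- r - 2)" if t: "t \<ge> 1" for t
  proof -
    define a b where "a = theta (y * t) - 1" and "b = theta (t / y) - 1"
    have a: "0 \<le> a" "a \<le> A * t powr (- q)" using A(2)[OF t] theta_ge_1[of "y * t"] y t by (auto simp: a_def)
    have b: "0 \<le> b" "b \<le> B * t powr (- q)" using B(2)[OF t] theta_ge_1[of "t / y"] y t by (auto simp: b_def)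
    have "t powr (- q) \<le> t powr 0" using t by (intro powr_mono) (auto simp: q_def)
    hence "A * t powr (- q) \<le> A * 1" using A t by (intro mult_left_mono) auto
    hence "a \<le> A" using a by simp
    hence "a * b \<le> A * (B * t powr (- q))" using a b by (intro mult_mono) auto
    hence "a * b + a + b \<le> (A * B + A + B) * t powr (- q)" using a b by (simp add: algebra_simps)
    also have "\<dots> \<le> (A * B + A + B) * t powr (- r - 2)"
      using t A B by (intro mult_left_mono powr_mono) (auto simp: q_def)
    finally have "a * b + a + b \<le> (A * B + A + B) * t powr (- r - 2)" .
    moreover have "theta2 y t - 1 = a * b + a + b" by (simp add: theta2_def a_def b_def algebra_simps)
    moreover have "a * b + a + b \<ge> 0" using a b by simp
    ultimately show ?thesis by simp
  qed
  thus ?thesis by blast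
qed

text \<open>The part of the Mellin transform that is entire in \<open>z\<close>.\<close>

definition theta2_tail :: "real \<Rightarrow> complex \<Rightarrow> complex" where
  "theta2_tail y z = (LBINT t:{1..}. of_real (theta2 y t - 1) * complex_of_real t powr z)"

lemma
  assumes y: "y > 0"
  shows theta2_tail_holomorphic: "theta2_tail y holomorphic_on UNIV"
    and theta2_tail_integrable: "set_integrable lborel {1..} (\<lambda>t. of_real (theta2 y t - 1) * complex_of_real t powr z)"
proof -
  have c: "continuous_on {1..} (\<lambda>t. theta2 y t - 1)"
    by (intro continuous_intros continuous_on_theta2 y) auto
  show "theta2_tail y holomorphic_on UNIV"
    unfolding theta2_tail_def[abs_def]
    by (rule rapid_decay_mellin_holomorphic[OF c theta2_rapid_decay[OF y]])
  obtain C where "\<And>t. t \<ge> 1 \<Longrightarrow> \<bar>theta2 y t - 1\<bar> \<le> C * t powr (- Re z - 2)"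
    using theta2_rapid_decay[OF y] by blast
  thus "set_integrable lborel {1..} (\<lambda>t. of_real (theta2 y t - 1) * complex_of_real t powr z)"
    by (rule rapid_decay_mellin_integrable(1)[OF c]) auto
qed

lemma set_integral_Ici_eq_Ioi:
  fixes f :: "real \<Rightarrow> complex"
  assumes "set_integrable lborel {c..} f"
  shows "(LBINT t:{c..}. f t) = (LBINT t:{c<..}. f t)"
proof (rule set_integral_cong_set)
  have "set_integrable lborel {c<..} f" by (rule set_integrable_subset[OF assms]) auto
  thus "set_borel_measurable lborel {c<..} f" "set_borel_measurable lborel {c..} f"
    using assms by (auto simp: set_borel_measurable_def set_integrable_def)
  show "AE t in lborel. (t \<in> {c<..}) = (t \<in> {c..})"
    using AE_lborel_singleton[of c] by eventually_elim auto
qed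

lemma set_integral_complex_powr_to_inf:
  assumes z: "Re z < -1"
  shows "set_integrable lborel {1..} (\<lambda>t. complex_of_real t powr z)"
    and "(LBINT t:{1..}. complex_of_real t powr z) = - 1 / (z + 1)"
proof -
  have cont: "continuous_on S (\<lambda>t. complex_of_real t powr z)" if "S \<subseteq> {0<..}" for S z
    by (rule continuous_on_of_real_powr[OF that])
  show I: "set_integrable lborel {1..} (\<lambda>t. complex_of_real t powr z)"
    by (rule set_integrable_continuous_dominated[OF set_integral_powr_to_inf(1)[OF zero_less_one z]])
       (auto intro!: cont simp: norm_of_real_powr)
  define F where "F = (\<lambda>t. complex_of_real t powr (z + 1) / (z + 1))"
  have nz: "z + 1 \<noteq> 0"
  proof
    assume "z + 1 = 0"
    hence "Re (z + 1) = Re 0" by simp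
    thus False using z by simp
  qed
  have "(LBINT t=ereal 1..\<infinity>. complex_of_real t powr z) = 0 - F 1"
  proof (rule interval_integral_FTC_integrable)
    show "(F has_vector_derivative complex_of_real t powr z) (at t)" if "ereal 1 < ereal t" for t
    proof -
      have t: "t > 1" using that by simp
      have "((\<lambda>w. w powr (z + 1) / (z + 1)) has_field_derivative (of_real t powr z)) (at (complex_of_real t))"
        using t nz by (auto intro!: derivative_eq_intros)
      from has_vector_derivative_real_field[OF this] show ?thesis
        by (simp add: F_def o_def)
    qed
    show "isCont (\<lambda>t. complex_of_real t powr z) t" if "ereal 1 < ereal t" for t
    proof -
      have "continuous_on {0<..} (\<lambda>t. complex_of_real t powr z)" by (rule cont) simp
      thus ?thesis using that by (simp add: continuous_on_eq_continuous_at)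
    qed
    show "set_integrable lborel (einterval (ereal 1) \<infinity>) (\<lambda>t. complex_of_real t powr z)"
      by (simp, rule set_integrable_subset[OF I]) auto
    have "continuous_on {0<..} F"
      unfolding F_def using nz by (intro continuous_intros cont) auto
    hence "isCont F 1" by (simp add: continuous_on_eq_continuous_at)
    hence "(F \<longlongrightarrow> F 1) (at_right 1)" by (simp add: isCont_def filterlim_at_split)
    thus "((F \<circ> real_of_ereal) \<longlongrightarrow> F 1) (at_right (ereal 1))" by (simp add: ereal_tendsto_simps)
    have "(F \<longlongrightarrow> 0) at_top"
    proof (rule tendsto_norm_zero_cancel, rule Lim_transform_eventually)
      have "((\<lambda>t. t powr Re (z + 1)) \<longlongrightarrow> 0) at_top"
        using z by (intro tendsto_neg_powr filterlim_ident) auto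
      thus "((\<lambda>t. t powr Re (z + 1) / norm (z + 1)) \<longlongrightarrow> 0) at_top"
        by (rule tendsto_divide_zero)
      show "\<forall>\<^sub>F t in at_top. t powr Re (z + 1) / norm (z + 1) = norm (F t)"
        using eventually_gt_at_top[of 0]
        by eventually_elim (simp add: F_def norm_divide norm_of_real_powr del: plus_complex.sel)
    qed
    thus "((F \<circ> real_of_ereal) \<longlongrightarrow> 0) (at_left \<infinity>)" by (simp add: ereal_tendsto_simps)
  qed simp
  also have "0 - F 1 = - 1 / (z + 1)" by (simp add: F_def)
  finally show "(LBINT t:{1..}. complex_of_real t powr z) = - 1 / (z + 1)"
    by (simp add: interval_integral_to_infinity_eq set_integral_Ici_eq_Ioi[OF I])
qed

text \<open>Riemann's method: the part over \<open>(0, 1]\<close> is carried to \<open>[1, \<infinity>)\<close> by the inversion of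
  \<open>theta2\<close>, where it leaves the two elementary integrals \<open>1/(s-1)\<close> and \<open>1/s\<close>. The right-hand side makes
  sense for every \<open>s\<close> other than \<open>0\<close> and \<open>1\<close>.\<close>

lemma theta2_mellin:
  assumes y: "y > 0" and s: "Re s > 1"
  shows "set_integrable lborel {0<..} (\<lambda>t. of_real (theta2 y t - 1) * complex_of_real t powr (s - 1))" (is "set_integrable _ _ ?f")
    and "(LBINT t:{0<..}. of_real (theta2 y t - 1) * complex_of_real t powr (s - 1)) =
      theta2_tail y (s - 1) + theta2_tail y (- s) + 1 / (s - 1) - 1 / s"
proof -
  let ?g = "\<lambda>t. of_real (theta2 y t - 1) * complex_of_real t powr (- s)"
  let ?h = "\<lambda>t. ?g t + (complex_of_real t powr (- s) - complex_of_real t powr (- s - 1))"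
  have cf: "continuous_on {0<..1} ?f"
    by (intro continuous_intros continuous_on_of_real_powr continuous_on_theta2 y) auto
  note inv = set_integral_inversion_complex[OF cf zero_less_one, unfolded div_by_1]
  have eq: "?f (1 / t) / of_real (t\<^sup>2) = ?h t" if "t \<in> {1..}" for t
  proof -
    have t: "t > 0" using that by simp
    \<comment> \<open>All powers are written as exponentials in \<open>L = log t\<close>, where the identity is algebraic.\<close>
    define L where "L = complex_of_real (ln t)"
    have "complex_of_real (1 / t) powr (s - 1) = exp (L - s * L)"
      using t of_real_powr_eq_exp[of "1 / t" "s - 1"] by (simp add: L_def ln_div algebra_simps)
    moreover have "complex_of_real (t\<^sup>2) = exp (2 * L)" "complex_of_real t = exp L"
    proof -
      show "complex_of_real t = exp L" using t by (simp add: L_def exp_of_real)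
      thus "complex_of_real (t\<^sup>2) = exp (2 * L)" by (simp add: exp_double)
    qed
    moreover have "complex_of_real t powr (- s) = exp (- s * L)" "complex_of_real t powr (- s - 1) = exp (- s * L - L)"
      using t by (simp_all add: of_real_powr_eq_exp L_def algebra_simps)
    moreover have "complex_of_real (theta2 y (1 / t) - 1) = complex_of_real t * of_real (theta2 y t) - 1"
      by (simp add: theta2_inversion[OF y t])
    moreover have "(exp L * w - 1) * exp (L - s * L) / exp (2 * L) = (w - 1) * exp (- s * L) + (exp (- s * L) - exp (- s * L - L))" for w
    proof -
      have "(exp L * w - 1) * exp (L - s * L) / exp (2 * L) = (exp L * w - 1) * exp (L - s * L - 2 * L)"
        by (simp only: exp_diff times_divide_eq_right)
      also have "L - s * L - 2 * L = - s * L - L" by simp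
      also have "(exp L * w - 1) * exp (- s * L - L) = (exp L * exp (- s * L - L)) * w - exp (- s * L - L)"
        by (simp add: algebra_simps)
      also have "exp L * exp (- s * L - L) = exp (- s * L)" by (simp add: exp_add[symmetric])
      finally show ?thesis by (simp add: algebra_simps)
    qed
    ultimately show ?thesis by simp
  qed
  have re: "Re (- s) < -1" "Re (- s - 1) < -1" using s by auto
  note P = set_integral_complex_powr_to_inf[OF re(1)] set_integral_complex_powr_to_inf[OF re(2)]
  note T = theta2_tail_integrable[OF y]
  have hint: "set_integrable lborel {1..} ?h"
    by (intro set_integral_add(1) set_integral_diff(1) T P)
  have hval: "(LBINT t:{1..}. ?h t) = theta2_tail y (- s) + (1 / (s - 1) - 1 / s)"
  proof -
    have "(LBINT t:{1..}. ?h t) = theta2_tail y (- s) + ((- 1 / (- s + 1)) - (- 1 / (- s - 1 + 1)))"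
      unfolding theta2_tail_def
      by (subst set_integral_add(2)[OF T set_integral_diff(1)[OF P(1) P(3)]])
         (simp only: set_integral_diff(2)[OF P(1) P(3)] P(2,4))
    also have "- 1 / (- s + 1) = 1 / (s - 1)"
      using minus_divide_divide[of 1 "s - 1"] by simp
    also have "- 1 / (- s - 1 + 1) = 1 / s" by simp
    finally show ?thesis .
  qed
  have "set_integrable lborel {1..} (\<lambda>t. ?f (1 / t) / of_real (t\<^sup>2))"
    using hint by (rule iffD1[OF set_integrable_cong, rotated -1]) (use eq in auto)
  hence A: "set_integrable lborel {0<..1} ?f" using inv(1) by simp
  show I: "set_integrable lborel {0<..} ?f"
    by (rule set_integrable_split_at[OF A T]) simp
  have "(LBINT t:{0<..}. ?f t) = (LBINT t:{0<..1}. ?f t) + theta2_tail y (s - 1)"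
    unfolding theta2_tail_def by (rule set_integral_split_at[OF I]) simp
  also have "(LBINT t:{0<..1}. ?f t) = (LBINT t:{1..}. ?h t)"
    unfolding inv(2) by (rule set_lebesgue_integral_cong) (use eq in auto)
  finally show "(LBINT t:{0<..}. ?f t) = theta2_tail y (s - 1) + theta2_tail y (- s) + 1 / (s - 1) - 1 / s"
    unfolding hval by simp
qed

lemma theta2_has_sum:
  assumes y: "y > 0" and t: "t > 0"
  shows "((\<lambda>(m::int, n::int). exp (- (pi * ((real_of_int m)\<^sup>2 * y + (real_of_int n)\<^sup>2 / y)) * t)) has_sum (theta2 y t - 1)) (UNIV - {(0, 0)})"
proof -
  let ?f = "\<lambda>(m::int, n::int). exp (- (pi * ((real_of_int m)\<^sup>2 * y + (real_of_int n)\<^sup>2 / y)) * t)"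
  have "((\<lambda>(m::int, n::int). exp (- pi * (real_of_int m)\<^sup>2 * (y * t)) * exp (- pi * (real_of_int n)\<^sup>2 * (t / y))) has_sum theta2 y t) (UNIV \<times> UNIV)"
    unfolding theta2_def by (intro has_sum_product_nonneg theta_has_sum) (use y t in auto)
  also have "(\<lambda>(m::int, n::int). exp (- pi * (real_of_int m)\<^sup>2 * (y * t)) * exp (- pi * (real_of_int n)\<^sup>2 * (t / y))) = ?f"
    by (auto simp: exp_add[symmetric] algebra_simps)
  finally have "(?f has_sum theta2 y t) UNIV" by simp
  moreover have "(?f has_sum 1) {(0, 0)}" by (rule has_sum_finiteI) auto
  ultimately show ?thesis by (rule has_sum_Diff) auto
qed

text \<open>Each lattice point contributes a Gamma integral of \<open>e\<^bsup>-\<pi> q t\<^esup>\<close> with \<open>q = |m i y + n|\<^sup>2 / y\<close>.\<close>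

lemma eisenstein_series_eq_mellin:
  assumes y: "y > 0" and s: "Re s > 1"
  shows "eisenstein_series (\<i> * complex_of_real y) s =
    1/2 * (LBINT t:{0<..}. of_real (theta2 y t - 1) * complex_of_real t powr (s - 1))"
proof -
  let ?A = "UNIV - {(0::int, 0::int)}"
  define q where "q = (\<lambda>p::int \<times> int. (real_of_int (fst p))\<^sup>2 * y + (real_of_int (snd p))\<^sup>2 / y)"
  have q: "q p > 0" if "p \<in> ?A" for p
    using that y by (cases p) (auto simp: q_def intro: add_pos_nonneg add_nonneg_pos)
  have s0: "Re s > 0" using s by simp
  define f where "f = (\<lambda>p t. complex_of_real (exp (- (pi * q p) * t)) * of_real t powr (s - 1))"
  have G: "set_integrable lborel {0<..} (f p)" "(LBINT t:{0<..}. f p t) = Gamma s * of_real (pi * q p) powr (- s)"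
    if "p \<in> ?A" for p
    using gamma_integral_scaled_complex[OF s0, of "pi * q p"] q[OF that] by (auto simp: f_def)
  have th: "((\<lambda>p. exp (- (pi * q p) * t)) has_sum (theta2 y t - 1)) ?A" if "t > 0" for t
    using theta2_has_sum[OF y that] by (simp add: q_def case_prod_unfold)
  have "((\<lambda>p. LBINT t:{0<..}. f p t) has_sum (LBINT t:{0<..}. (\<Sum>\<^sub>\<infinity>p\<in>?A. f p t))) ?A"
  proof (rule has_sum_set_integral[OF G(1)])
    show "((\<lambda>p. norm (f p t)) has_sum ((theta2 y t - 1) * t powr (Re s - 1))) ?A" if "t \<in> {0<..}" for t
      using has_sum_cmult_left[OF th[of t], of "t powr (Re s - 1)"] that
      by (simp add: f_def norm_mult norm_of_real_powr)
    have "set_integrable lborel {0<..} (\<lambda>t. norm (of_real (theta2 y t - 1) * complex_of_real t powr (s - 1)))"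
      by (intro set_integrable_norm theta2_mellin y s)
    thus "set_integrable lborel {0<..} (\<lambda>t. (theta2 y t - 1) * t powr (Re s - 1))"
    proof (rule iffD1[OF set_integrable_cong, rotated -1])
      show "norm (of_real (theta2 y t - 1) * complex_of_real t powr (s - 1)) = (theta2 y t - 1) * t powr (Re s - 1)"
        if "t \<in> {0<..}" for t
        using theta2_ge_1[OF y, of t] that
        by (simp add: norm_mult norm_of_real_powr del: of_real_diff)
    qed auto
  qed
  also have "(LBINT t:{0<..}. (\<Sum>\<^sub>\<infinity>p\<in>?A. f p t)) =
      (LBINT t:{0<..}. of_real (theta2 y t - 1) * complex_of_real t powr (s - 1))"
  proof (rule set_lebesgue_integral_cong)
    show "\<forall>t. t \<in> {0<..} \<longrightarrow> (\<Sum>\<^sub>\<infinity>p\<in>?A. f p t) = of_real (theta2 y t - 1) * complex_of_real t powr (s - 1)"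
    proof (intro allI impI)
      fix t :: real assume "t \<in> {0<..}"
      hence "t > 0" by simp
      from infsumI[OF has_sum_cmult_left[OF has_sum_of_real[OF th[OF this]]]]
      show "(\<Sum>\<^sub>\<infinity>p\<in>?A. f p t) = of_real (theta2 y t - 1) * complex_of_real t powr (s - 1)"
        unfolding f_def .
    qed
  qed simp
  finally have sum: "((\<lambda>p. LBINT t:{0<..}. f p t) has_sum
      (LBINT t:{0<..}. of_real (theta2 y t - 1) * complex_of_real t powr (s - 1))) ?A" .
  let ?K = "complex_of_real pi powr (- s) * Gamma s"
  let ?e = "\<lambda>(m::int, n::int). complex_of_real (Im (\<i> * complex_of_real y)) powr s /
      complex_of_real (cmod (of_int m * (\<i> * complex_of_real y) + of_int n)) powr (2 * s)"
  have summand: "(LBINT t:{0<..}. f p t) = ?K * ?e p" if p: "p \<in> ?A" for p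
  proof -
    obtain m n where mn: "p = (m, n)" by (cases p)
    define N where "N = (real_of_int m)\<^sup>2 * y\<^sup>2 + (real_of_int n)\<^sup>2"
    have qN: "q p = N / y" using y by (simp add: q_def mn N_def field_simps power2_eq_square)
    have N: "N > 0" using q[OF p] y by (simp add: qN zero_less_divide_iff)
    have cm: "cmod (of_int m * (\<i> * complex_of_real y) + of_int n) = sqrt N"
      by (simp add: cmod_def N_def power_mult_distrib add.commute)
    have "complex_of_real (sqrt N) powr (2 * s) = of_real N powr s"
      using N by (simp add: of_real_powr_eq_exp ln_sqrt)
    hence e: "?e p = of_real y powr s / of_real N powr s" by (simp add: mn cm)
    have P: "complex_of_real (pi * q p) powr (- s) = of_real pi powr (- s) * (of_real y powr s / of_real N powr s)"
      using y N unfolding qN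
      by (simp add: of_real_powr_eq_exp ln_mult ln_div exp_add[symmetric] exp_diff[symmetric] exp_minus[symmetric] algebra_simps del: of_real_mult of_real_divide)
    show ?thesis unfolding G(2)[OF p] P e by simp
  qed
  have "(\<Sum>\<^sub>\<infinity>p\<in>?A. ?K * ?e p) = (\<Sum>\<^sub>\<infinity>p\<in>?A. LBINT t:{0<..}. f p t)"
    by (rule infsum_cong) (simp only: summand)
  also have "\<dots> = (LBINT t:{0<..}. of_real (theta2 y t - 1) * complex_of_real t powr (s - 1))"
    using sum by (rule infsumI)
  finally have "?K * (\<Sum>\<^sub>\<infinity>p\<in>?A. ?e p) = (LBINT t:{0<..}. of_real (theta2 y t - 1) * complex_of_real t powr (s - 1))"
    by (simp only: infsum_cmult_right')
  thus ?thesis unfolding eisenstein_series_def by (simp only: mult.assoc)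
qed

text \<open>The right-hand side is a continuation, so the choice defining \<open>eisenstein_star\<close> ranges over a nonempty
  set; by the identity theorem on the connected set \<open>- {0, 1}\<close> the chosen function has the same values.\<close>

lemma eisenstein_star_eq:
  assumes y: "y > 0" and s: "s \<noteq> 0" "s \<noteq> 1"
  shows "eisenstein_star (\<i> * complex_of_real y) s =
    1/2 * (theta2_tail y (s - 1) + theta2_tail y (- s) + 1 / (s - 1) - 1 / s)"
proof -
  define g where "g = (\<lambda>s. 1/2 * (theta2_tail y (s - 1) + theta2_tail y (- s) + 1 / (s - 1) - 1 / s))"
  let ?P = "\<lambda>f. f holomorphic_on (- {0, 1}) \<and> (\<forall>s. Re s > 1 \<longrightarrow> f s = eisenstein_series (\<i> * complex_of_real y) s)"
  have hol: "(\<lambda>s. theta2_tail y (s - 1)) holomorphic_on (- {0, 1})" "(\<lambda>s. theta2_tail y (- s)) holomorphic_on (- {0, 1})"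
  proof -
    have "(theta2_tail y \<circ> (\<lambda>s. s - 1)) holomorphic_on (- {0, 1})" "(theta2_tail y \<circ> uminus) holomorphic_on (- {0, 1})"
      by (rule holomorphic_on_compose_gen[OF _ theta2_tail_holomorphic[OF y]]; auto intro!: holomorphic_intros)+
    thus "(\<lambda>s. theta2_tail y (s - 1)) holomorphic_on (- {0, 1})" "(\<lambda>s. theta2_tail y (- s)) holomorphic_on (- {0, 1})"
      by (simp_all add: o_def)
  qed
  have g_hol: "g holomorphic_on (- {0, 1})"
    unfolding g_def by (intro holomorphic_intros hol) auto
  have g: "?P g"
  proof (intro conjI g_hol allI impI)
    fix s :: complex assume s: "Re s > 1"
    show "g s = eisenstein_series (\<i> * complex_of_real y) s"
      unfolding g_def eisenstein_series_eq_mellin[OF y s] theta2_mellin(2)[OF y s] ..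
  qed
  hence E: "?P (eisenstein_star (\<i> * complex_of_real y))"
    using someI[of ?P g] unfolding eisenstein_star_def by blast
  have "eisenstein_star (\<i> * complex_of_real y) s = g s"
  proof (rule analytic_continuation_open[of "{s. Re s > 1}" "- {0, 1}" "eisenstein_star (\<i> * complex_of_real y)" g])
    show "open {s. Re s > 1}" by (rule open_halfspace_Re_gt)
    have "2 \<in> {s. Re s > 1}" by simp
    thus "{s. Re s > 1} \<noteq> {}" by blast
    show "connected (- {0, 1 :: complex})"
      by (intro path_connected_imp_connected path_connected_complement_countable) auto
    show "eisenstein_star (\<i> * complex_of_real y) holomorphic_on - {0, 1}" using E by blast
    show "eisenstein_star (\<i> * complex_of_real y) z = g z" if "z \<in> {s. Re s > 1}" for z
      using that E g by simp
  qed (use g_hol s in auto)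
  thus ?thesis by (simp add: g_def)
qed

section \<open>The value at one half\<close>

text \<open>At \<open>s = 1/2\<close> the two tails coincide and the polar terms add up to \<open>-4\<close>.\<close>

lemma E_half_eq:
  assumes y: "y > 0"
  shows "E_half y = of_real ((LBINT t:{1..}. (theta2 y t - 1) * t powr (-1/2)) - 2)"
    and theta2_tail_half_integrable: "set_integrable lborel {1..} (\<lambda>t. (theta2 y t - 1) * t powr (-1/2))"
proof -
  let ?f = "\<lambda>t. (theta2 y t - 1) * t powr (-1/2)"
  have eq: "of_real (theta2 y t - 1) * complex_of_real t powr (-1/2) = of_real (?f t)" if "t \<in> {1..}" for t
    using that powr_of_real[of t "-1/2"] by simp
  have "theta2_tail y (-1/2) = (LBINT t:{1..}. complex_of_real (?f t))"
    unfolding theta2_tail_def by (rule set_lebesgue_integral_cong) (use eq in auto)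
  also have "\<dots> = of_real (LBINT t:{1..}. ?f t)" by (rule set_integral_complex_of_real)
  finally have tail: "theta2_tail y (-1/2) = of_real (LBINT t:{1..}. ?f t)" .
  have E: "E_half y = 1/2 * (theta2_tail y (1/2 - 1) + theta2_tail y (- (1/2)) + 1 / (1/2 - 1) - 1 / (1/2))"
    unfolding E_half_def by (rule eisenstein_star_eq[OF y]) auto
  have h: "1/2 - 1 = (-1/2 :: complex)" "- (1/2) = (-1/2 :: complex)" by simp_all
  show "E_half y = of_real ((LBINT t:{1..}. ?f t) - 2)"
    unfolding E h tail by simp
  have "set_integrable lborel {1..} (\<lambda>t. complex_of_real (?f t))"
    using theta2_tail_integrable[OF y, of "-1/2"]
    by (rule iffD1[OF set_integrable_cong, rotated -1]) (use eq in auto)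
  thus "set_integrable lborel {1..} ?f" by (subst (asm) set_integrable_complex_iff) simp
qed

text \<open>The two pieces of the regularized transform, cut at \<open>Y = 1/y\<close> and moved to \<open>[1, \<infinity>)\<close>, the first by scaling, the
  second by \<open>t \<mapsto> 1/t\<close> and scaling. They are the terms by which \<open>theta_conv y\<close> differs from the integral for \<open>E\<close>.\<close>

lemma theta_regularized_at_half_rescaled:
  assumes y: "y > 0"
  shows "set_integrable lborel {1..} (\<lambda>t. (theta (t / y) - 1) * t powr (-1/2))"
    and "set_integrable lborel {1..} (\<lambda>t. (theta (y * t) - 1) / t)"
    and "theta_regularized (1 / y) (-1/2) =
      (LBINT t:{1..}. (theta (t / y) - 1) * t powr (-1/2)) / sqrt y + (LBINT t:{1..}. (theta (y * t) - 1) / t)"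
proof -
  have y1: "1 / y > 0" using y by simp
  note D = theta_regularized_dominated[OF y1]
  let ?b = "\<lambda>t. (theta t - 1) * t powr (-1/2)"
  let ?c = "\<lambda>t. (theta t - t powr (-1/2)) * t powr (-1/2)"
  have b_int: "set_integrable lborel {1/y..} ?b"
    by (rule set_integrable_continuous_dominated[OF D(1) D(5)]) (use D(3)[of _ "-1/2"] in auto)
  have c_int: "set_integrable lborel {0<..1/y} ?c"
    by (rule set_integrable_continuous_dominated[OF D(2) D(6)]) (use D(4)[of _ "-1/2"] in auto)
  note rb = set_integral_rescale[OF y1 D(5)[of "-1/2"]]
  have b_eq: "1 / y * ?b (1 / y * t) = (theta (t / y) - 1) * t powr (-1/2) / sqrt y" if "t \<in> {1..}" for t
  proof -
    have "(1 / y * t) powr (-1/2) = sqrt y * t powr (-1/2)"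
      using y that by (simp add: powr_divide powr_minus powr_half_sqrt field_simps)
    moreover have "1 / y * (w * (sqrt y * p)) = w * p / sqrt y" for w p
    proof -
      have "sqrt y / y = 1 / sqrt y" using y by (simp add: real_div_sqrt field_simps)
      thus ?thesis by (simp add: field_simps)
    qed
    ultimately show ?thesis by simp
  qed
  have "set_integrable lborel {1..} (\<lambda>t. (theta (t / y) - 1) * t powr (-1/2) / sqrt y)"
    using iffD1[OF rb(2) b_int]
    by (rule iffD1[OF set_integrable_cong, rotated -1]) (use b_eq in auto)
  thus "set_integrable lborel {1..} (\<lambda>t. (theta (t / y) - 1) * t powr (-1/2))"
    using y by simp
  have B: "(LBINT t:{1/y..}. ?b t) = (LBINT t:{1..}. (theta (t / y) - 1) * t powr (-1/2)) / sqrt y"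
  proof -
    have "(LBINT t:{1/y..}. ?b t) = (LBINT t:{1..}. (theta (t / y) - 1) * t powr (-1/2) / sqrt y)"
      unfolding rb(1) by (rule set_lebesgue_integral_cong) (use b_eq in auto)
    thus ?thesis by simp
  qed
  note ic = set_integral_inversion_real[OF D(6)[of "-1/2"] y1]
  have c_eq: "?c (1 / t) / t\<^sup>2 = (theta t - 1) / t" if "t \<in> {y..}" for t
  proof -
    have t: "t > 0" using that y by simp
    have "?c (1 / t) = ((1 / t) powr (-1/2) * (1 / t) powr (-1/2)) * (theta t - 1)"
      using t by (simp only: theta_minus_powr_eq[of "1 / t"] zero_less_divide_1_iff) simp
    also have "(1 / t) powr (-1/2) * (1 / t) powr (-1/2) = t"
      by (subst powr_add[symmetric]) (use t in \<open>simp add: powr_minus\<close>)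
    finally show ?thesis using t by (simp add: power2_eq_square)
  qed
  have ct: "continuous_on {y..} (\<lambda>t. (theta t - 1) / t)"
    using y by (intro continuous_intros) auto
  have c_eq': "y * ((theta (y * t) - 1) / (y * t)) = (theta (y * t) - 1) / t" for t
    using y by simp
  note rc = set_integral_rescale[OF y ct, unfolded c_eq']
  have "set_integrable lborel {y..} (\<lambda>t. ?c (1 / t) / t\<^sup>2)" using ic(1) c_int by simp
  hence "set_integrable lborel {y..} (\<lambda>t. (theta t - 1) / t)"
    by (rule iffD1[OF set_integrable_cong, rotated -1]) (use c_eq in auto)
  thus "set_integrable lborel {1..} (\<lambda>t. (theta (y * t) - 1) / t)" using rc(2) by simp
  have "(LBINT t:{0<..1/y}. ?c t) = (LBINT t:{y..}. ?c (1 / t) / t\<^sup>2)" using ic(2) by simp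
  also have "\<dots> = (LBINT t:{y..}. (theta t - 1) / t)"
    by (rule set_lebesgue_integral_cong) (use c_eq in auto)
  also have "\<dots> = (LBINT t:{1..}. (theta (y * t) - 1) / t)" by (rule rc(1))
  finally show "theta_regularized (1 / y) (-1/2) =
      (LBINT t:{1..}. (theta (t / y) - 1) * t powr (-1/2)) / sqrt y + (LBINT t:{1..}. (theta (y * t) - 1) / t)"
    unfolding theta_regularized_def B by simp
qed

text \<open>The relation behind the second formula. On \<open>[1, \<infinity>)\<close> inversion of the factor \<open>\<theta>(y/t)\<close> turns the
  integrand of \<open>theta_conv\<close> into the integrand of \<open>E_half_eq\<close> divided by \<open>sqrt y\<close>, minus two one-dimensional
  integrands whose total is the regularized transform at \<open>-1/2\<close>.\<close>

lemma theta_conv_eq_E_half: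
  assumes y: "y > 0"
  shows "complex_of_real (theta_conv y) = E_half y / of_real (sqrt y) - of_real (ln (Q_const * y))"
proof -
  \<comment> \<open>In these terms \<open>E_half y = A - 2\<close> and \<open>theta_conv y = (A - B) / sqrt y - C\<close>.\<close>
  define A where "A = (LBINT t:{1..}. (theta2 y t - 1) * t powr (-1/2))"
  define B where "B = (LBINT t:{1..}. (theta (t / y) - 1) * t powr (-1/2))"
  define C where "C = (LBINT t:{1..}. (theta (y * t) - 1) / t)"
  note R = theta_regularized_at_half_rescaled[OF y]
  note A_int = theta2_tail_half_integrable[OF y]
  have "theta_conv y = (LBINT t:{1..}. (theta (y * t) - 1) * (theta (y / t) - 1) / t)"
    by (rule theta_conv_eq_half[OF y])
  also have "\<dots> = (LBINT t:{1..}. ((theta2 y t - 1) * t powr (-1/2) - (theta (t / y) - 1) * t powr (-1/2)) / sqrt y - (theta (y * t) - 1) / t)"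
  proof (rule set_lebesgue_integral_cong)
    show "\<forall>t. t \<in> {1..} \<longrightarrow> (theta (y * t) - 1) * (theta (y / t) - 1) / t =
        ((theta2 y t - 1) * t powr (-1/2) - (theta (t / y) - 1) * t powr (-1/2)) / sqrt y - (theta (y * t) - 1) / t"
    proof (intro allI impI)
      fix t :: real assume "t \<in> {1..}"
      hence t: "t > 0" by simp
      have "theta (y / t) = sqrt (t / y) * theta (t / y)"
        using theta_inversion[of "t / y"] y t by simp
      moreover have "(a - 1) * (r * b - 1) / t = ((a * b - 1) - (b - 1)) * (r / t) - (a - 1) / t" for a b r
        using t by (simp add: field_simps)
      moreover have "sqrt (t / y) / t = t powr (-1/2) / sqrt y"
      proof -
        have "sqrt t * sqrt t = t" using t by simp
        hence half: "sqrt t / t = t powr (-1/2)"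
          using t by (simp add: powr_minus powr_half_sqrt field_simps)
        have "sqrt (t / y) / t = (sqrt t / t) / sqrt y" by (simp add: real_sqrt_divide)
        thus ?thesis by (simp only: half)
      qed
      ultimately have "(theta (y * t) - 1) * (theta (y / t) - 1) / t =
          ((theta2 y t - 1) - (theta (t / y) - 1)) * (t powr (-1/2) / sqrt y) - (theta (y * t) - 1) / t"
        by (simp only: theta2_def)
      thus "(theta (y * t) - 1) * (theta (y / t) - 1) / t =
        ((theta2 y t - 1) * t powr (-1/2) - (theta (t / y) - 1) * t powr (-1/2)) / sqrt y - (theta (y * t) - 1) / t"
        by (simp only: left_diff_distrib times_divide_eq_right)
    qed
  qed simp
  also have "\<dots> = (A - B) / sqrt y - C"
    unfolding A_def B_def C_def
    by (subst set_integral_diff(2) set_integral_divide_zero | intro set_integrable_divide set_integral_diff(1) A_int R)+ simp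
  also have "\<dots> = (A - 2) / sqrt y - (theta_regularized (1 / y) (-1/2) - 2 / sqrt y)"
  proof -
    have "theta_regularized (1 / y) (-1/2) = B / sqrt y + C" unfolding B_def C_def by (rule R(3))
    thus ?thesis by (simp add: diff_divide_distrib)
  qed
  also have "theta_regularized (1 / y) (-1/2) - 2 / sqrt y = ln (Q_const * y)"
  proof -
    have "theta_regularized (1 / y) (-1/2) = euler_mascheroni - ln (4 * pi) - ln (1 / y) + 2 * sqrt (1 / y)"
      using y by (intro theta_regularized_at_half) simp
    moreover have "ln (Q_const * y) = euler_mascheroni - ln (4 * pi) + ln y"
      using y by (simp add: Q_const_def ln_mult ln_div inverse_eq_divide)
    ultimately show ?thesis using y by (simp add: ln_div real_sqrt_divide)
  qed
  finally have "theta_conv y = (A - 2) / sqrt y - ln (Q_const * y)" .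
  moreover have "E_half y = of_real (A - 2)" unfolding A_def by (rule E_half_eq[OF y])
  ultimately show ?thesis by simp
qed

theorem proposition5:
  fixes x \<nu> :: real
  assumes "x > 0" and "\<nu> > 0"
  shows "((\<lambda>k. 4 * (real (sigma0 (Suc k)) *
            (bessel_K 0 (2 * pi * real (Suc k) * \<nu> / x\<^sup>2)
             - x\<^sup>2 * bessel_K 0 (2 * pi * real (Suc k) * \<nu> * x\<^sup>2)))) sums V_fun x \<nu>) \<and>
         complex_of_real (V_fun x \<nu>) =
           complex_of_real (x\<^sup>2 * ln (x\<^sup>2) + x\<^sup>2 * ln (Q_const * \<nu>) + ln (x\<^sup>2) - ln (Q_const * \<nu>))
           + complex_of_real (x / sqrt \<nu>) * (E_half (\<nu> / x\<^sup>2) - E_half (\<nu> * x\<^sup>2))"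
proof (intro conjI)
  have pos: "\<nu> / x\<^sup>2 > 0" "\<nu> * x\<^sup>2 > 0" using assms by simp_all
  note V = V_fun_eq_theta_conv[OF assms]
  have "4 * (real (sigma0 (Suc k)) * (bessel_K 0 (2 * pi * real (Suc k) * \<nu> / x\<^sup>2)
             - x\<^sup>2 * bessel_K 0 (2 * pi * real (Suc k) * \<nu> * x\<^sup>2))) =
        4 * (real (sigma0 (Suc k)) * bessel_K 0 (2 * pi * real (Suc k) * (\<nu> / x\<^sup>2))) -
        x\<^sup>2 * (4 * (real (sigma0 (Suc k)) * bessel_K 0 (2 * pi * real (Suc k) * (\<nu> * x\<^sup>2))))" for k
    by (simp only: times_divide_eq_right mult.assoc[of _ \<nu> "x\<^sup>2"] right_diff_distrib) (simp only: mult_ac)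
  thus "(\<lambda>k. 4 * (real (sigma0 (Suc k)) *
            (bessel_K 0 (2 * pi * real (Suc k) * \<nu> / x\<^sup>2)
             - x\<^sup>2 * bessel_K 0 (2 * pi * real (Suc k) * \<nu> * x\<^sup>2)))) sums V_fun x \<nu>"
    using sums_diff[OF theta_conv_sums[OF pos(1)] sums_mult[OF theta_conv_sums[OF pos(2)], of "x\<^sup>2"]]
    by (simp only: V)
  have Q: "Q_const * \<nu> > 0" "Q_const \<noteq> 0" using assms by (simp_all add: Q_const_def)
  have sq: "sqrt (\<nu> / x\<^sup>2) = sqrt \<nu> / x" "sqrt (\<nu> * x\<^sup>2) = sqrt \<nu> * x"
    using assms by (simp_all add: real_sqrt_divide real_sqrt_mult)
  have lnQ: "ln (Q_const * (\<nu> / x\<^sup>2)) = ln (Q_const * \<nu>) - ln (x\<^sup>2)"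
    "ln (Q_const * (\<nu> * x\<^sup>2)) = ln (Q_const * \<nu>) + ln (x\<^sup>2)"
    using assms Q ln_div[of "Q_const * \<nu>" "x\<^sup>2"] ln_mult[of "Q_const * \<nu>" "x\<^sup>2"]
    by (simp_all add: mult.assoc)
  have E1: "E_half (\<nu> / x\<^sup>2) / of_real (sqrt (\<nu> / x\<^sup>2)) = of_real (x / sqrt \<nu>) * E_half (\<nu> / x\<^sup>2)"
    unfolding sq by simp
  have E2: "of_real (x\<^sup>2) * (E_half (\<nu> * x\<^sup>2) / of_real (sqrt (\<nu> * x\<^sup>2))) = of_real (x / sqrt \<nu>) * E_half (\<nu> * x\<^sup>2)"
    unfolding sq using assms by (simp add: power2_eq_square)
  have "complex_of_real (V_fun x \<nu>) = of_real (theta_conv (\<nu> / x\<^sup>2)) - of_real (x\<^sup>2) * of_real (theta_conv (\<nu> * x\<^sup>2))"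
    unfolding V by simp
  also have "\<dots> = (of_real (x / sqrt \<nu>) * E_half (\<nu> / x\<^sup>2) - of_real (ln (Q_const * \<nu>) - ln (x\<^sup>2))) -
      (of_real (x / sqrt \<nu>) * E_half (\<nu> * x\<^sup>2) - of_real (x\<^sup>2) * of_real (ln (Q_const * \<nu>) + ln (x\<^sup>2)))"
    unfolding theta_conv_eq_E_half[OF pos(1)] theta_conv_eq_E_half[OF pos(2)] right_diff_distrib E1 E2 lnQ ..
  also have "\<dots> = complex_of_real (x\<^sup>2 * ln (x\<^sup>2) + x\<^sup>2 * ln (Q_const * \<nu>) + ln (x\<^sup>2) - ln (Q_const * \<nu>))
           + complex_of_real (x / sqrt \<nu>) * (E_half (\<nu> / x\<^sup>2) - E_half (\<nu> * x\<^sup>2))"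
    by (simp only: of_real_add of_real_diff of_real_mult) (simp add: algebra_simps)
  finally show "complex_of_real (V_fun x \<nu>) =
           complex_of_real (x\<^sup>2 * ln (x\<^sup>2) + x\<^sup>2 * ln (Q_const * \<nu>) + ln (x\<^sup>2) - ln (Q_const * \<nu>))
           + complex_of_real (x / sqrt \<nu>) * (E_half (\<nu> / x\<^sup>2) - E_half (\<nu> * x\<^sup>2))" .
qed

end
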